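(* Let $m\ge n$ be positive integers. The product relations generating $\mathcal{P}_{n,m}$ are contained in $\mathbb{K}[E_{n,m}]$, hence (regarding $\mathcal{P}_{n,m}$ as the ideal of $\mathbb{K}[E_{n,m}]$ they generate) there is an algebra isomorphism $$\mathcal{T}_{n,m}\;\cong\;\mathbb{K}[E_{n,m}]/\mathcal{P}_{n,m}\;\otimes\;\mathbb{K}[F_{n,m}].$$ Moreover, $\mathcal{P}_{n,m}$ is prime in $\mathbb{K}[E_{n,m}]$, and the ideal of $\mathcal{T}_{n,m}$ given by its image is prime in $\mathcal{T}_{n,m}$.
   Context: Let $\mathbb{K}$ be an algebraically closed field of characteristic zero. A semistandard Young tableau of partition shape $\lambda$ is a filling of the Ferrers diagram of $\lambda$ (English notation) with positive integers, strictly increasing down columns and weakly increasing from left to right along rows. For positive integers $m\ge n$, $\mathrm{SSYT}_m^n$ denotes the set of all semistandard Young tableaux of all partition shapes with at most $n$ rows and with entries in $\{1,\dots,m\}$ (including the empty tableau $\emptyset$). For $T$ of shape $\lambda$ and $T'$ of shape $\mu$, $T\star T'$ is the semistandard Young tableau of shape $\lambda+\mu$ obtained by horizontally concatenating the rows of $T$ and $T'$ and sorting the entries in each row in weakly increasing order. $(\mathrm{SSYT}_m^n,\star,\emptyset)$ is a commutative monoid, and the tableaux algebra $\mathcal{T}_{n,m}$ is its monoid algebra over $\mathbb{K}$. Let $G_{n,m}$ be the set of tableaux in $\mathrm{SSYT}_m^n$ with exactly one column (of height $1,\dots,n$). Write $[a_1,\dots,a_k]$ for the column with entries $a_1<\dots<a_k$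 from top to bottom. Set $F_{n,n}=\{[n],\,[1,2,\dots,n-1],\,[1,2,\dots,n]\}$ (for $n=1$ this is just $\{[1]\}$), and $F_{n,m}=\{[m],\,[1,2,\dots,n]\}$ if $m\ne n$. Set $E_{n,m}=G_{n,m}\setminus F_{n,m}$. For a finite set $Y$, $\mathbb{K}[Y]$ is the polynomial ring in commuting variables indexed by $Y$. $\mathcal{P}_{n,m}$ is the ideal of $\mathbb{K}[G_{n,m}]$ generated by all product relations, i.e. all $T_1T_2-T_3T_4$ with $T_1,T_2,T_3,T_4\in G_{n,m}$ distinct and $T_1\star T_2=T_3\star T_4$ in $\mathrm{SSYT}_m^n$. The map $\mathbb{K}[G_{n,m}]\to\mathcal{T}_{n,m}$ sends each variable to the corresponding tableau. Tensor products are over $\mathbb{K}$. *)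

theory Defs
  imports
    "HOL-Computational_Algebra.Polynomial"
    "HOL-Library.Poly_Mapping"
    "HOL-Library.Multiset"
    "HOL-Algebra.QuotRing"
    "HOL-Algebra.Module"
begin

section \<open>Algebras over a field\<close>

text \<open>
  The coefficient field is a type \<open>'k\<close> of class \<^class>\<open>field\<close>. A \<open>'k\<close>-algebra is a record of type
  \<open>('k, 'a) module\<close>, which has the ring operations and a scalar multiplication.
\<close>

definition algebra_isomorphic :: "('k, 'a) module \<Rightarrow> ('k, 'b) module \<Rightarrow> bool"
  where "algebra_isomorphic A B \<longleftrightarrow>
    (\<exists>h \<in> ring_iso A B. \<forall>c. \<forall>x \<in> carrier A. h (c \<odot>\<^bsub>A\<^esub> x) = c \<odot>\<^bsub>B\<^esub> h x)"

definition quotient_algebra :: "('k, 'a) module \<Rightarrow> 'a set \<Rightarrow> ('k, 'a set) module"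
  where "quotient_algebra A I =
    \<lparr>carrier = carrier (A Quot I), mult = mult (A Quot I), one = one (A Quot I),
     zero = zero (A Quot I), add = add (A Quot I),
     smult = (\<lambda>c X. \<Union>x\<in>X. I +>\<^bsub>A\<^esub> (c \<odot>\<^bsub>A\<^esub> x))\<rparr>"

text \<open>Formal linear combinations of elements of \<open>M\<close>, multiplied by bilinear extension.\<close>

definition monoid_algebra :: "('a, 'x) monoid_scheme \<Rightarrow> ('k::field, 'a \<Rightarrow>\<^sub>0 'k) module"
  where "monoid_algebra M =
    \<lparr>carrier = {p. Poly_Mapping.keys p \<subseteq> carrier M},
     mult = (\<lambda>p q. \<Sum>a\<in>Poly_Mapping.keys p. \<Sum>b\<in>Poly_Mapping.keys q.
       Poly_Mapping.single (a \<otimes>\<^bsub>M\<^esub> b) (Poly_Mapping.lookup p a * Poly_Mapping.lookup q b)),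
     one = Poly_Mapping.single \<one>\<^bsub>M\<^esub> 1,
     zero = 0,
     add = (+),
     smult = (\<lambda>c. Poly_Mapping.map ((*) c))\<rparr>"

text \<open>Monomials in the variables \<open>Y\<close> are finite multisets of elements of \<open>Y\<close>.\<close>

definition monomial_monoid :: "'v set \<Rightarrow> 'v multiset monoid"
  where "monomial_monoid Y = \<lparr>carrier = {u. set_mset u \<subseteq> Y}, mult = (+), one = {#}\<rparr>"

definition polynomial_algebra :: "'v set \<Rightarrow> ('k::field, 'v multiset \<Rightarrow>\<^sub>0 'k) module"
  where "polynomial_algebra Y = monoid_algebra (monomial_monoid Y)"

text \<open>
  The tensor product is the free vector space on \<open>A \<times> B\<close> modulo the bilinearity relations.
  With the product \<open>(a, b) (a', b') = (a a', b b')\<close> this free vector space is the monoid algebra of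
  \<open>A \<times> B\<close>. The linear span of the bilinearity relations is closed under multiplication by basis
  elements, so it equals the ideal they generate.
\<close>

definition bilinearity_relations ::
    "('k::field, 'a) module \<Rightarrow> ('k, 'b) module \<Rightarrow> ('a \<times> 'b \<Rightarrow>\<^sub>0 'k) set"
  where "bilinearity_relations A B =
    {Poly_Mapping.single (a \<oplus>\<^bsub>A\<^esub> a', b) 1 - Poly_Mapping.single (a, b) 1 - Poly_Mapping.single (a', b) 1
      | a a' b. a \<in> carrier A \<and> a' \<in> carrier A \<and> b \<in> carrier B} \<union>
    {Poly_Mapping.single (a, b \<oplus>\<^bsub>B\<^esub> b') 1 - Poly_Mapping.single (a, b) 1 - Poly_Mapping.single (a, b') 1
      | a b b'. a \<in> carrier A \<and> b \<in> carrier B \<and> b' \<in> carrier B} \<union>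
    {Poly_Mapping.single (c \<odot>\<^bsub>A\<^esub> a, b) 1 - Poly_Mapping.single (a, b) c
      | c a b. a \<in> carrier A \<and> b \<in> carrier B} \<union>
    {Poly_Mapping.single (a, c \<odot>\<^bsub>B\<^esub> b) 1 - Poly_Mapping.single (a, b) c
      | c a b. a \<in> carrier A \<and> b \<in> carrier B}"

definition tensor_algebra ::
    "('k::field, 'a) module \<Rightarrow> ('k, 'b) module \<Rightarrow> ('k, ('a \<times> 'b \<Rightarrow>\<^sub>0 'k) set) module"
  where "tensor_algebra A B =
    quotient_algebra (monoid_algebra (A \<times>\<times> B))
      (Idl\<^bsub>monoid_algebra (A \<times>\<times> B)\<^esub> (bilinearity_relations A B))"


section \<open>Semistandard Young tableaux\<close>

text \<open>
  A tableau is the list of its rows from top to bottom. All rows are nonempty, so that a filling of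
  a Ferrers diagram has exactly one representation.
\<close>

type_synonym tableau = "nat list list"

definition semistandard :: "tableau \<Rightarrow> bool"
  where "semistandard T \<longleftrightarrow>
    (\<forall>r \<in> set T. r \<noteq> [] \<and> sorted r \<and> 0 \<notin> set r) \<and>
    sorted_wrt (\<ge>) (map length T) \<and>
    (\<forall>i j. Suc i < length T \<and> j < length (T ! Suc i) \<longrightarrow> T ! i ! j < T ! Suc i ! j)"

definition SSYT :: "nat \<Rightarrow> nat \<Rightarrow> tableau set"
  where "SSYT n m = {T. semistandard T \<and> length T \<le> n \<and> (\<forall>r \<in> set T. set r \<subseteq> {1..m})}"

fun star :: "tableau \<Rightarrow> tableau \<Rightarrow> tableau" (infixl \<open>\<star>\<close> 70)
  where
    "[] \<star> U = U"
  | "T \<star> [] = T"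
  | "(r # T) \<star> (s # U) = sort (r @ s) # (T \<star> U)"

definition tableau_monoid :: "nat \<Rightarrow> nat \<Rightarrow> tableau monoid"
  where "tableau_monoid n m = \<lparr>carrier = SSYT n m, mult = (\<star>), one = []\<rparr>"

definition tableaux_algebra :: "nat \<Rightarrow> nat \<Rightarrow> ('k::field, tableau \<Rightarrow>\<^sub>0 'k) module"
  where "tableaux_algebra n m = monoid_algebra (tableau_monoid n m)"

definition column :: "nat list \<Rightarrow> tableau"
  where "column as = map (\<lambda>a. [a]) as"

text \<open>The number of columns of a nonempty tableau is the length of its first row.\<close>

definition G :: "nat \<Rightarrow> nat \<Rightarrow> tableau set"
  where "G n m = {T \<in> SSYT n m. T \<noteq> [] \<and> length (hd T) = 1}"

text \<open>For \<open>m = n = 1\<close> the list \<open>[1..<n]\<close> is empty and does not give a column.\<close>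

definition F :: "nat \<Rightarrow> nat \<Rightarrow> tableau set"
  where "F n m =
    (if m = n then {column [n], column [1..<n], column [1..<Suc n]} - {[]}
     else {column [m], column [1..<Suc n]})"

definition E :: "nat \<Rightarrow> nat \<Rightarrow> tableau set"
  where "E n m = G n m - F n m"


section \<open>Product relations\<close>

type_synonym 'k tableau_poly = "tableau multiset \<Rightarrow>\<^sub>0 'k"

definition product_relations :: "nat \<Rightarrow> nat \<Rightarrow> 'k::field tableau_poly set"
  where "product_relations n m =
    {Poly_Mapping.single {#T1, T2#} 1 - Poly_Mapping.single {#T3, T4#} 1 | T1 T2 T3 T4.
      {T1, T2, T3, T4} \<subseteq> G n m \<and> distinct [T1, T2, T3, T4] \<and> T1 \<star> T2 = T3 \<star> T4}"

text \<open>Generated as an ideal of the polynomial algebra in the variables \<open>E n m\<close>, not \<open>G n m\<close>.\<close>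

definition product_ideal :: "nat \<Rightarrow> nat \<Rightarrow> 'k::field tableau_poly set"
  where "product_ideal n m = Idl\<^bsub>polynomial_algebra (E n m)\<^esub> (product_relations n m)"

text \<open>
  The algebra homomorphism from the polynomial algebra in the variables \<open>G n m\<close> to the tableaux
  algebra that sends each variable to the corresponding tableau; a monomial goes to the \<open>\<star>\<close>-product of its variables.
\<close>

definition tableau_map :: "nat \<Rightarrow> nat \<Rightarrow> 'k::field tableau_poly \<Rightarrow> (tableau \<Rightarrow>\<^sub>0 'k)"
  where "tableau_map n m p =
    (\<Sum>u\<in>Poly_Mapping.keys p. Poly_Mapping.single
      (\<Otimes>\<^bsub>tableau_monoid n m\<^esub>T\<in>set_mset u. T [^]\<^bsub>tableau_monoid n m\<^esub> count u T)
      (Poly_Mapping.lookup p u))"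

end

theory Submission
  imports Defs "HOL-Library.Nat_Bijection"
begin

text \<open>
  The \<^emph>\<open>content\<close> of a tableau is the multiset of all pairs (row, entry). Sorting a row does not change
  it, so \<open>\<star>\<close> becomes addition of contents; conversely a semistandard tableau can be read off from its
  content. The tableaux algebra therefore embeds into a polynomial ring with one variable for each
  such pair (\<open>tableau_value\<close>), and it is an integral domain. The polynomial algebra on the columns
  maps to the same ring (\<open>poly_value\<close>), and two monomials have the same value iff they have the same
  total content.

  \<^emph>\<open>Straightening.\<close> Columns form a lattice under rowwise minimum and maximum, a missing entry at the
  bottom of a shorter column counting as infinite. The contents of two columns and of their meet and
  join have the same sum, so for incomparable columns \<open>c\<close>, \<open>d\<close> the exchange of \<open>c d\<close> for
  \<open>(c \<and> d) (c \<or> d)\<close> is a product relation. Such exchanges produce a column that lies below all the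
  others, and this least column is determined by the total content. Splitting it off and inducting
  on the size shows that two monomials with the same total content differ by a chain of product
  relations (\<open>product_equivalent_if_content_eq\<close>).

  \<^emph>\<open>The columns in\<close> \<open>F\<close>. Each of them contains a cell that no column outside \<open>F\<close> can contain: with rows
  numbered from 0, the entry \<open>m\<close> in row 0 forces \<open>[m]\<close>, the entry \<open>n\<close> in row \<open>n - 1\<close> forces
  \<open>[1, \<dots>, n]\<close>, and for \<open>m = n\<close> the entry \<open>n - 1\<close> in row \<open>n - 2\<close> forces \<open>[1, \<dots>, n - 1]\<close> or
  \<open>[1, \<dots>, n]\<close>. If a column of \<open>F\<close> occurs on one side of an equation
  \<open>T1 \<star> T2 = T3 \<star> T4\<close>, it therefore occurs on both sides or \<open>[1, \<dots>, n]\<close> does, and both are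
  excluded when the four columns are distinct (\<open>product_relation_in_E\<close>).

  \<^emph>\<open>Conclusion.\<close> Product relations only change the \<open>E\<close>-part of a monomial in the columns. So the product
  ideal is the whole kernel of \<open>poly_value\<close> on the \<open>E\<close>-variables, and it is prime because the target
  is a domain; its image in the tableaux algebra is the zero ideal, which is prime for the same
  reason. Sending a tableau to the class of its \<open>E\<close>-part tensor its \<open>F\<close>-part is
  multiplicative. The resulting map to the tensor product is onto because tensors of monomials span,
  and one-to-one because the map induced by \<open>poly_value\<close> on both tensor factors recovers
  \<open>tableau_value\<close>.
\<close>

section \<open>Linear extension and monoid algebras\<close>

text \<open>
  A constant of its own, so that rewriting with the commutativity of multiplication does not reach the
  mapped function.
\<close>

definition scale :: "'k::field \<Rightarrow> ('a \<Rightarrow>\<^sub>0 'k) \<Rightarrow> ('a \<Rightarrow>\<^sub>0 'k)"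
  where "scale c = Poly_Mapping.map ((*) c)"

lemma lookup_scale [simp]: "Poly_Mapping.lookup (scale c p) a = c * Poly_Mapping.lookup p a"
  by (simp add: scale_def Poly_Mapping.map.rep_eq when_def)

lemma scale_single [simp]: "scale c (Poly_Mapping.single a d) = Poly_Mapping.single a (c * d)"
  by (simp add: scale_def)

lemma scale_simps [simp]:
  "scale c 0 = 0" "scale 0 p = 0" "scale 1 p = p"
  "scale c (scale d p) = scale (c * d) p"
  by (auto intro!: poly_mapping_eqI)

lemma scale_distrib:
  "scale c (p + q) = scale c p + scale c q" "scale (c + d) p = scale c p + scale d p"
  "scale c (p - q) = scale c p - scale c q"
  by (auto intro!: poly_mapping_eqI simp: lookup_add lookup_minus algebra_simps)

lemma scale_sum: "scale c (\<Sum>a\<in>A. f a) = (\<Sum>a\<in>A. scale c (f a))"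
  by (induction A rule: infinite_finite_induct) (auto simp: scale_distrib)

lemma keys_scale: "Poly_Mapping.keys (scale c p) \<subseteq> Poly_Mapping.keys p"
  by (auto simp: in_keys_iff)

definition lin_ext :: "('a \<Rightarrow> ('b \<Rightarrow>\<^sub>0 'k)) \<Rightarrow> ('a \<Rightarrow>\<^sub>0 'k::field) \<Rightarrow> ('b \<Rightarrow>\<^sub>0 'k)"
  where "lin_ext f p = (\<Sum>a\<in>Poly_Mapping.keys p. scale (Poly_Mapping.lookup p a) (f a))"

lemma lin_ext_superset:
  assumes "finite S" "Poly_Mapping.keys p \<subseteq> S"
  shows "lin_ext f p = (\<Sum>a\<in>S. scale (Poly_Mapping.lookup p a) (f a))"
  unfolding lin_ext_def using assms by (intro sum.mono_neutral_left) (auto simp: in_keys_iff)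

lemma lin_ext_add: "lin_ext f (p + q) = lin_ext f p + lin_ext f q"
proof -
  let ?S = "Poly_Mapping.keys p \<union> Poly_Mapping.keys q"
  show ?thesis
    by (simp add: lin_ext_superset[of ?S] keys_add lookup_add scale_distrib sum.distrib)
qed

lemma lin_ext_single [simp]: "lin_ext f (Poly_Mapping.single a c) = scale c (f a)"
  by (simp add: lin_ext_def)

lemma lin_ext_zero [simp]: "lin_ext f 0 = 0"
  by (simp add: lin_ext_def)

lemma lin_ext_diff: "lin_ext f (p - q) = lin_ext f p - lin_ext f q"
  using lin_ext_add[of f "p - q" q] by (simp add: algebra_simps)

lemma lin_ext_sum: "lin_ext f (\<Sum>a\<in>A. g a) = (\<Sum>a\<in>A. lin_ext f (g a))"
  by (induction A rule: infinite_finite_induct) (auto simp: lin_ext_add)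

lemma lin_ext_scale: "lin_ext f (scale c p) = scale c (lin_ext f p)"
  by (simp add: lin_ext_superset[of "Poly_Mapping.keys p", OF finite_keys keys_scale] scale_sum)
     (simp add: lin_ext_def scale_sum)

lemma lin_ext_lin_ext: "lin_ext f (lin_ext g p) = lin_ext (\<lambda>a. lin_ext f (g a)) p"
  unfolding lin_ext_def[of g] lin_ext_sum lin_ext_scale by (simp add: lin_ext_def)

lemma lin_ext_cong: "(\<And>a. a \<in> Poly_Mapping.keys p \<Longrightarrow> f a = g a) \<Longrightarrow> lin_ext f p = lin_ext g p"
  by (simp add: lin_ext_def)

lemma lin_ext_id: "lin_ext (\<lambda>a. Poly_Mapping.single a 1) p = p"
  by (rule poly_mapping_eqI) (auto simp: lin_ext_def lookup_sum lookup_single when_def in_keys_iff)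

lemma lin_ext_fun_add: "lin_ext (\<lambda>a. f a + g a) p = lin_ext f p + lin_ext g p"
  by (simp add: lin_ext_def scale_distrib sum.distrib)

lemma lin_ext_fun_scale: "lin_ext (\<lambda>a. scale c (f a)) p = scale c (lin_ext f p)"
  by (simp add: lin_ext_def scale_sum mult.commute)

lemma keys_lin_ext:
  assumes "\<And>a. a \<in> Poly_Mapping.keys p \<Longrightarrow> Poly_Mapping.keys (f a) \<subseteq> S"
  shows "Poly_Mapping.keys (lin_ext f p) \<subseteq> S"
  unfolding lin_ext_def
  by (rule order_trans[OF keys_sum]) (use assms keys_scale in fastforce)

text \<open>
  An element supported in \<open>S\<close> is a finite sum of terms with basis elements in \<open>S\<close>, so an
  identity between linear maps need only be checked on basis elements.
\<close>

lemma span_induct: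
  fixes p :: "'a \<Rightarrow>\<^sub>0 'k::field"
  assumes "Poly_Mapping.keys p \<subseteq> S" "P 0"
    and "\<And>a c q. a \<in> S \<Longrightarrow> Poly_Mapping.keys q \<subseteq> S \<Longrightarrow> P q \<Longrightarrow> P (Poly_Mapping.single a c + q)"
  shows "P p"
proof -
  have "Poly_Mapping.keys (\<Sum>a\<in>A. Poly_Mapping.single a (Poly_Mapping.lookup p a)) \<subseteq> S \<and>
    P (\<Sum>a\<in>A. Poly_Mapping.single a (Poly_Mapping.lookup p a))" if "finite A" "A \<subseteq> S" for A
    using that
  proof (induction rule: finite_induct)
    case (insert a A)
    let ?q = "\<Sum>a\<in>A. Poly_Mapping.single a (Poly_Mapping.lookup p a)"
    have *: "Poly_Mapping.keys (Poly_Mapping.single a (Poly_Mapping.lookup p a) + ?q) \<subseteq> S"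
      by (rule order_trans[OF keys_add]) (use insert in auto)
    from insert assms(3)[of a ?q "Poly_Mapping.lookup p a"] * show ?case by simp
  qed (use assms(2) in auto)
  from this[OF finite_keys assms(1)] show ?thesis
    using lin_ext_id[of p] by (simp add: lin_ext_def)
qed

lemma monoid_algebra_simps [simp]:
  "carrier (monoid_algebra M) = {p. Poly_Mapping.keys p \<subseteq> carrier M}"
  "\<one>\<^bsub>monoid_algebra M\<^esub> = Poly_Mapping.single \<one>\<^bsub>M\<^esub> 1"
  "\<zero>\<^bsub>monoid_algebra M\<^esub> = 0"
  "p \<oplus>\<^bsub>monoid_algebra M\<^esub> q = p + q"
  "c \<odot>\<^bsub>monoid_algebra M\<^esub> p = scale c p"
  by (simp_all add: monoid_algebra_def scale_def)

text \<open>
  Writing the product as an iterated linear extension makes its bilinearity an instance of the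
  linearity of \<open>lin_ext\<close>.
\<close>

lemma monoid_algebra_mult:
  "p \<otimes>\<^bsub>monoid_algebra M\<^esub> q =
    lin_ext (\<lambda>a. lin_ext (\<lambda>b. Poly_Mapping.single (a \<otimes>\<^bsub>M\<^esub> b) 1) q) p"
  by (simp add: monoid_algebra_def lin_ext_def scale_sum)

lemma monoid_algebra_mult_single [simp]:
  "Poly_Mapping.single a c \<otimes>\<^bsub>monoid_algebra M\<^esub> Poly_Mapping.single b d =
    Poly_Mapping.single (a \<otimes>\<^bsub>M\<^esub> b) (c * d)"
  by (simp add: monoid_algebra_mult)

lemma monoid_algebra_mult_bilinear:
  "(p + p') \<otimes>\<^bsub>monoid_algebra M\<^esub> q = p \<otimes>\<^bsub>monoid_algebra M\<^esub> q + p' \<otimes>\<^bsub>monoid_algebra M\<^esub> q"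
  "p \<otimes>\<^bsub>monoid_algebra M\<^esub> (q + q') = p \<otimes>\<^bsub>monoid_algebra M\<^esub> q + p \<otimes>\<^bsub>monoid_algebra M\<^esub> q'"
  "scale c p \<otimes>\<^bsub>monoid_algebra M\<^esub> q = scale c (p \<otimes>\<^bsub>monoid_algebra M\<^esub> q)"
  "p \<otimes>\<^bsub>monoid_algebra M\<^esub> scale c q = scale c (p \<otimes>\<^bsub>monoid_algebra M\<^esub> q)"
  "0 \<otimes>\<^bsub>monoid_algebra M\<^esub> q = 0"
  "p \<otimes>\<^bsub>monoid_algebra M\<^esub> 0 = 0"
  by (simp_all add: monoid_algebra_mult lin_ext_add lin_ext_scale lin_ext_fun_add lin_ext_fun_scale)
     (simp add: lin_ext_def)

lemma (in comm_monoid) cring_monoid_algebra: "cring (monoid_algebra G :: ('k::field, 'a \<Rightarrow>\<^sub>0 'k) module)"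
proof (rule cringI)
  let ?A = "monoid_algebra G :: ('k::field, 'a \<Rightarrow>\<^sub>0 'k) module"
  note bl = monoid_algebra_mult_bilinear
  show "abelian_group ?A"
  proof (rule abelian_groupI)
    fix p assume p: "p \<in> carrier ?A"
    show "\<exists>q\<in>carrier ?A. q \<oplus>\<^bsub>?A\<^esub> p = \<zero>\<^bsub>?A\<^esub>"
      by (rule bexI[of _ "- p"]) (use p in simp_all)
  qed (auto simp: add_ac dest: subsetD[OF keys_add])
  have clos: "p \<otimes>\<^bsub>?A\<^esub> q \<in> carrier ?A" if "p \<in> carrier ?A" "q \<in> carrier ?A" for p q
    using that by (force simp: monoid_algebra_mult intro!: keys_lin_ext)
  have comm: "p \<otimes>\<^bsub>?A\<^esub> q = q \<otimes>\<^bsub>?A\<^esub> p" if "p \<in> carrier ?A" "q \<in> carrier ?A" for p q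
  proof -
    have single: "Poly_Mapping.single a c \<otimes>\<^bsub>?A\<^esub> q = q \<otimes>\<^bsub>?A\<^esub> Poly_Mapping.single a c"
      if "a \<in> carrier G" "Poly_Mapping.keys q \<subseteq> carrier G" for a c q
      using that(2) by (rule span_induct) (use that(1) in \<open>simp_all add: bl m_comm mult.commute\<close>)
    from that(1) have "Poly_Mapping.keys p \<subseteq> carrier G" by simp
    then show ?thesis
      by (rule span_induct) (use that in \<open>simp_all add: bl single\<close>)
  qed
  have assoc: "p \<otimes>\<^bsub>?A\<^esub> q \<otimes>\<^bsub>?A\<^esub> r = p \<otimes>\<^bsub>?A\<^esub> (q \<otimes>\<^bsub>?A\<^esub> r)"
    if "p \<in> carrier ?A" "q \<in> carrier ?A" "r \<in> carrier ?A" for p q r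
  proof -
    have 1: "Poly_Mapping.single a c \<otimes>\<^bsub>?A\<^esub> Poly_Mapping.single b d \<otimes>\<^bsub>?A\<^esub> r =
        Poly_Mapping.single a c \<otimes>\<^bsub>?A\<^esub> (Poly_Mapping.single b d \<otimes>\<^bsub>?A\<^esub> r)"
      if "a \<in> carrier G" "b \<in> carrier G" "Poly_Mapping.keys r \<subseteq> carrier G" for a b c d r
      using that(3) by (rule span_induct) (use that in \<open>simp_all add: bl m_assoc mult.assoc del: monoid_algebra_mult_single\<close>, simp_all add: m_assoc mult.assoc that)
    have 2: "Poly_Mapping.single a c \<otimes>\<^bsub>?A\<^esub> q \<otimes>\<^bsub>?A\<^esub> r =
        Poly_Mapping.single a c \<otimes>\<^bsub>?A\<^esub> (q \<otimes>\<^bsub>?A\<^esub> r)"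
      if "a \<in> carrier G" "Poly_Mapping.keys q \<subseteq> carrier G" "Poly_Mapping.keys r \<subseteq> carrier G" for a c q r
      using that(2) by (rule span_induct) (use that in \<open>simp_all add: bl 1 del: monoid_algebra_mult_single\<close>)
    from that(1) have "Poly_Mapping.keys p \<subseteq> carrier G" by simp
    then show ?thesis
      by (rule span_induct) (use that in \<open>simp_all add: bl 2\<close>)
  qed
  show "comm_monoid ?A"
  proof (rule comm_monoidI)
    fix p assume "p \<in> carrier ?A"
    then have "Poly_Mapping.keys p \<subseteq> carrier G" by simp
    then show "\<one>\<^bsub>?A\<^esub> \<otimes>\<^bsub>?A\<^esub> p = p"
      by (rule span_induct) (simp_all add: bl)
  qed (use clos comm assoc in \<open>simp_all\<close>)
qed (simp add: monoid_algebra_mult_bilinear)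

text \<open>
  The universal property of a commutative monoid algebra, for maps into another commutative monoid algebra: a
  multiplicative map on the basis extends to a ring homomorphism.
\<close>

lemma lin_ext_ring_hom:
  assumes M: "comm_monoid M" and N: "comm_monoid N"
    and f: "f \<in> hom M (monoid_algebra N)" "f \<one>\<^bsub>M\<^esub> = \<one>\<^bsub>monoid_algebra N\<^esub>"
  shows "lin_ext f \<in> ring_hom (monoid_algebra M) (monoid_algebra N :: ('k::field, 'b \<Rightarrow>\<^sub>0 'k) module)"
proof (rule ring_hom_memI)
  let ?A = "monoid_algebra M :: ('k::field, 'a \<Rightarrow>\<^sub>0 'k) module"
  let ?B = "monoid_algebra N :: ('k::field, 'b \<Rightarrow>\<^sub>0 'k) module"
  interpret A: cring ?A using M by (rule comm_monoid.cring_monoid_algebra)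
  interpret B: cring ?B using N by (rule comm_monoid.cring_monoid_algebra)
  note bl = monoid_algebra_mult_bilinear
  have fc: "Poly_Mapping.keys (f a) \<subseteq> carrier N" if "a \<in> carrier M" for a
    using hom_in_carrier[OF f(1) that] by simp
  show "lin_ext f p \<in> carrier ?B" if "p \<in> carrier ?A" for p
    using that fc by (auto intro!: keys_lin_ext)
  show "lin_ext f (p \<otimes>\<^bsub>?A\<^esub> q) = lin_ext f p \<otimes>\<^bsub>?B\<^esub> lin_ext f q"
    if "p \<in> carrier ?A" "q \<in> carrier ?A" for p q
  proof -
    have 1: "lin_ext f (Poly_Mapping.single a c \<otimes>\<^bsub>?A\<^esub> q) = scale c (f a) \<otimes>\<^bsub>?B\<^esub> lin_ext f q"
      if "a \<in> carrier M" "Poly_Mapping.keys q \<subseteq> carrier M" for a c q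
      using that(2) by (rule span_induct)
        (use that(1) hom_mult[OF f(1)] in \<open>simp_all add: bl lin_ext_add mult.commute\<close>)
    from that(1) have "Poly_Mapping.keys p \<subseteq> carrier M" by simp
    then show ?thesis
      by (rule span_induct) (use that in \<open>simp_all add: bl lin_ext_add 1\<close>)
  qed
qed (use f(2) in \<open>simp_all add: lin_ext_add\<close>)



definition basis_map :: "('a \<Rightarrow> 'b) \<Rightarrow> ('a \<Rightarrow>\<^sub>0 'k::field) \<Rightarrow> ('b \<Rightarrow>\<^sub>0 'k)"
  where "basis_map g = lin_ext (\<lambda>a. Poly_Mapping.single (g a) 1)"

lemma basis_map_simps [simp]:
  "basis_map g 0 = 0"
  "basis_map g (Poly_Mapping.single a c) = Poly_Mapping.single (g a) c"
  "basis_map g (p + q) = basis_map g p + basis_map g q"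
  "basis_map g (p - q) = basis_map g p - basis_map g q"
  "basis_map g (scale c p) = scale c (basis_map g p)"
  by (simp_all add: basis_map_def lin_ext_add lin_ext_diff lin_ext_scale)

lemma lin_ext_basis_map: "lin_ext f (basis_map g p) = lin_ext (\<lambda>a. f (g a)) p"
  by (simp add: basis_map_def lin_ext_lin_ext)

lemma basis_map_basis_map: "basis_map f (basis_map g p) = basis_map (\<lambda>a. f (g a)) p"
  by (simp add: basis_map_def lin_ext_lin_ext)

lemma basis_map_cong: "(\<And>a. a \<in> Poly_Mapping.keys p \<Longrightarrow> f a = g a) \<Longrightarrow> basis_map f p = basis_map g p"
  unfolding basis_map_def by (rule lin_ext_cong) simp

lemma basis_map_ring_hom:
  assumes "comm_monoid M" "comm_monoid N" "g \<in> hom M N" "g \<one>\<^bsub>M\<^esub> = \<one>\<^bsub>N\<^esub>"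
  shows "basis_map g \<in> ring_hom (monoid_algebra M) (monoid_algebra N :: ('k::field, _) module)"
  unfolding basis_map_def
  by (rule lin_ext_ring_hom) (use assms in \<open>auto simp: hom_def Pi_def\<close>)

text \<open>
  A left inverse of \<open>g\<close> on \<open>S\<close> induces a left inverse of \<open>basis_map g\<close>.
\<close>

lemma basis_map_inj_on:
  assumes "inj_on g S"
  shows "inj_on (basis_map g :: _ \<Rightarrow> _ \<Rightarrow>\<^sub>0 'k::field) {p. Poly_Mapping.keys p \<subseteq> S}"
proof (rule inj_on_inverseI)
  fix p :: "_ \<Rightarrow>\<^sub>0 'k" assume p: "p \<in> {p. Poly_Mapping.keys p \<subseteq> S}"
  have "basis_map (inv_into S g) (basis_map g p) = basis_map (\<lambda>a. a) p"
    unfolding basis_map_basis_map by (rule basis_map_cong) (use p assms in auto)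
  then show "basis_map (inv_into S g) (basis_map g p) = p" by (simp add: basis_map_def lin_ext_id)
qed

lemma monomial_monoid_simps [simp]:
  "carrier (monomial_monoid Y) = {u. set_mset u \<subseteq> Y}"
  "u \<otimes>\<^bsub>monomial_monoid Y\<^esub> v = u + v"
  "\<one>\<^bsub>monomial_monoid Y\<^esub> = {#}"
  by (simp_all add: monomial_monoid_def)

lemma comm_monoid_monomial_monoid: "comm_monoid (monomial_monoid Y)"
  by (rule comm_monoidI) auto

lemma cring_polynomial_algebra: "cring (polynomial_algebra Y :: ('k::field, _) module)"
  unfolding polynomial_algebra_def by (rule comm_monoid.cring_monoid_algebra[OF comm_monoid_monomial_monoid])


section \<open>Quotients of monoid algebras\<close>

text \<open>
  A quotient algebra and the underlying quotient ring are records of different types that share their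
  ring operations; this transfers the ring axioms from one to the other.
\<close>

lemma cring_cong_operations:
  assumes "cring R" "carrier S = carrier R" "mult S = mult R" "one S = one R" "zero S = zero R"
    "add S = add R"
  shows "cring S"
proof -
  interpret R: cring R by fact
  show ?thesis
  proof (rule cringI)
    show "abelian_group S"
      by (rule abelian_groupI) (use assms R.l_neg in \<open>auto simp: R.a_ac intro: bexI[of _ "\<ominus>\<^bsub>R\<^esub> _"]\<close>)
    show "comm_monoid S"
      by (rule comm_monoidI) (use assms in \<open>auto simp: R.m_ac\<close>)
  qed (use assms in \<open>auto simp: R.l_distr\<close>)
qed

lemma quotient_algebra_simps:
  "carrier (quotient_algebra A I) = carrier (A Quot I)"
  "mult (quotient_algebra A I) = mult (A Quot I)"
  "one (quotient_algebra A I) = one (A Quot I)"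
  "zero (quotient_algebra A I) = zero (A Quot I)"
  "add (quotient_algebra A I) = add (A Quot I)"
  by (simp_all add: quotient_algebra_def)

lemma carrier_quotient_algebra:
  "carrier (quotient_algebra A I) = (\<lambda>x. I +>\<^bsub>A\<^esub> x) ` carrier A"
  unfolding quotient_algebra_simps by (auto simp: FactRing_def A_RCOSETS_def' a_r_coset_def')

lemma cring_quotient_algebra:
  assumes "ideal I A" "cring A"
  shows "cring (quotient_algebra A I)"
  by (rule cring_cong_operations[OF ideal.quotient_is_cring[OF assms]])
     (simp_all add: quotient_algebra_simps)

lemma quotient_map_ring_hom:
  assumes "ideal I A"
  shows "(\<lambda>x. I +>\<^bsub>A\<^esub> x) \<in> ring_hom A (quotient_algebra A I)"
  using ideal.rcos_ring_hom[OF assms]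
  by (simp add: ring_hom_def quotient_algebra_simps)

lemma coset_eq_iff:
  assumes "ideal I A" "x \<in> carrier A" "y \<in> carrier A"
  shows "I +>\<^bsub>A\<^esub> x = I +>\<^bsub>A\<^esub> y \<longleftrightarrow> x \<ominus>\<^bsub>A\<^esub> y \<in> I"
proof -
  interpret ideal I A by fact
  have "I +>\<^bsub>A\<^esub> x = I +>\<^bsub>A\<^esub> y \<longleftrightarrow> x \<in> I +>\<^bsub>A\<^esub> y"
    using a_repr_independence'[of x y] a_repr_independenceD[of x y] assms by auto
  then show ?thesis
    using a_rcos_module_minus[of y x] ring_axioms assms by simp
qed

lemma (in comm_monoid) monoid_algebra_minus:
  assumes "p \<in> carrier (monoid_algebra G)" "q \<in> carrier (monoid_algebra G)"
  shows "p \<ominus>\<^bsub>monoid_algebra G\<^esub> q = (p - q :: 'a \<Rightarrow>\<^sub>0 'k::field)"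
proof -
  interpret A: cring "monoid_algebra G :: ('k, 'a \<Rightarrow>\<^sub>0 'k) module" by (rule cring_monoid_algebra)
  have "\<ominus>\<^bsub>monoid_algebra G\<^esub> q = - q"
    by (rule A.minus_equality) (use assms in auto)
  then show ?thesis by (simp add: a_minus_def)
qed

text \<open>Scaling by \<open>c\<close> is multiplication by \<open>c\<close> times the unit element.\<close>

lemma (in comm_monoid) ideal_scale:
  assumes "ideal I (monoid_algebra G)" "p \<in> I"
  shows "scale (c :: 'k::field) p \<in> I"
proof -
  interpret ideal I "monoid_algebra G :: ('k, 'a \<Rightarrow>\<^sub>0 'k) module" by fact
  have p: "Poly_Mapping.keys p \<subseteq> carrier G" using Icarr[OF assms(2)] by simp
  have "Poly_Mapping.single \<one> c \<otimes>\<^bsub>monoid_algebra G\<^esub> p = scale c (\<one>\<^bsub>monoid_algebra G\<^esub> \<otimes>\<^bsub>monoid_algebra G\<^esub> p)"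
    by (simp flip: monoid_algebra_mult_bilinear(3))
  also have "\<dots> = scale c p"
    using p by (subst l_one) simp_all
  finally show ?thesis
    using I_l_closed[OF assms(2), of "Poly_Mapping.single \<one> c"] by simp
qed

lemma (in comm_monoid) ideal_add:
  assumes "ideal I (monoid_algebra G)" "p \<in> I" "q \<in> I"
  shows "p + q \<in> (I :: ('a \<Rightarrow>\<^sub>0 'k::field) set)"
proof -
  interpret ideal I "monoid_algebra G :: ('k, 'a \<Rightarrow>\<^sub>0 'k) module" by fact
  show ?thesis
    using additive_subgroup.a_closed[OF additive_subgroup_axioms assms(2,3)] by simp
qed

lemma (in comm_monoid) ideal_zero:
  assumes "ideal I (monoid_algebra G)"
  shows "0 \<in> (I :: ('a \<Rightarrow>\<^sub>0 'k::field) set)"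
  using additive_subgroup.zero_closed[OF ideal.axioms(1)[OF assms]] by simp

lemma (in comm_monoid) monoid_algebra_coset_eq_iff:
  assumes "ideal I (monoid_algebra G)"
    "Poly_Mapping.keys p \<subseteq> carrier G" "Poly_Mapping.keys q \<subseteq> carrier G"
  shows "I +>\<^bsub>monoid_algebra G\<^esub> p = I +>\<^bsub>monoid_algebra G\<^esub> q \<longleftrightarrow> p - (q :: 'a \<Rightarrow>\<^sub>0 'k::field) \<in> I"
  using coset_eq_iff[OF assms(1), of p q] monoid_algebra_minus[of p q] assms by simp

text \<open>
  The scalar multiple of a coset is defined as a union over its elements; as the ideal is closed under
  scaling, each element contributes the same coset.
\<close>

lemma (in comm_monoid) quotient_monoid_algebra_smult:
  assumes I: "ideal I (monoid_algebra G)" and p: "Poly_Mapping.keys p \<subseteq> carrier G"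
  shows "c \<odot>\<^bsub>quotient_algebra (monoid_algebra G) I\<^esub> (I +>\<^bsub>monoid_algebra G\<^esub> p) =
    I +>\<^bsub>monoid_algebra G\<^esub> scale (c :: 'k::field) p"
proof -
  interpret ideal I "monoid_algebra G :: ('k, 'a \<Rightarrow>\<^sub>0 'k) module" by fact
  let ?C = "I +>\<^bsub>monoid_algebra G\<^esub> p"
  have sub: "?C \<subseteq> carrier (monoid_algebra G)"
    using a_rcosets_carrier[OF a_rcosetsI[OF a_subset]] p by simp
  have "I +>\<^bsub>monoid_algebra G\<^esub> scale c q = I +>\<^bsub>monoid_algebra G\<^esub> scale c p" if "q \<in> ?C" for q
  proof -
    have q: "Poly_Mapping.keys q \<subseteq> carrier G" using that sub by auto
    have "q - p \<in> I"
      using that p q a_rcos_module_minus[of p q] monoid_algebra_minus[of q p] ring_axioms by simp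
    then have "scale c q - scale c p \<in> I"
      using ideal_scale[OF I] by (simp flip: scale_distrib(3))
    moreover have "Poly_Mapping.keys (scale c q) \<subseteq> carrier G" "Poly_Mapping.keys (scale c p) \<subseteq> carrier G"
      using order_trans[OF keys_scale p] order_trans[OF keys_scale q] by simp_all
    ultimately show ?thesis by (simp add: monoid_algebra_coset_eq_iff[OF I])
  qed
  then have "(\<lambda>q. I +>\<^bsub>monoid_algebra G\<^esub> scale c q) ` ?C \<subseteq> {I +>\<^bsub>monoid_algebra G\<^esub> scale c p}"
    by auto
  moreover have "p \<in> ?C" using a_rcos_self p by simp
  ultimately have "(\<lambda>q. I +>\<^bsub>monoid_algebra G\<^esub> scale c q) ` ?C = {I +>\<^bsub>monoid_algebra G\<^esub> scale c p}"
    by auto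
  then show ?thesis by (simp add: quotient_algebra_def)
qed

section \<open>The content of a tableau\<close>

text \<open>
  The row index starts at \<open>i\<close> so that the recursion over the rows can pass to the remaining rows.
\<close>

primrec content_from :: "nat \<Rightarrow> tableau \<Rightarrow> (nat \<times> nat) multiset"
  where
    "content_from i [] = {#}"
  | "content_from i (r # T) = image_mset (Pair i) (mset r) + content_from (Suc i) T"

abbreviation content :: "tableau \<Rightarrow> (nat \<times> nat) multiset"
  where "content \<equiv> content_from 0"

lemma content_star: "content_from i (T \<star> U) = content_from i T + content_from i U"
  by (induction T U arbitrary: i rule: star.induct) (auto simp: ac_simps)

lemma content_from_ge: "(k, a) \<in># content_from i T \<Longrightarrow> i \<le> k"
  by (induction T arbitrary: i) force+

lemma in_content_from:
  "(i + k, a) \<in># content_from i T \<longleftrightarrow> k < length T \<and> a \<in> set (T ! k)"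
proof (induction T arbitrary: i k)
  case (Cons r T)
  show ?case
  proof (cases k)
    case 0
    then show ?thesis using content_from_ge[of i a "Suc i" T] by auto
  next
    case (Suc j)
    then show ?thesis using Cons.IH[of "Suc i" j] by auto
  qed
qed simp

lemma in_content_column: "(k, a) \<in># content (column c) \<longleftrightarrow> k < length c \<and> c ! k = a"
  using in_content_from[of 0 k a "column c"] by (auto simp: column_def)

text \<open>
  The pairs with first component \<open>i\<close> determine the entries of the top row, and a sorted row is
  determined by its entries. That rows are nonempty excludes that one tableau continues where
  the other one has ended.
\<close>

lemma content_from_inj:
  assumes "\<forall>r\<in>set T. r \<noteq> [] \<and> sorted r" "\<forall>r\<in>set U. r \<noteq> [] \<and> sorted r"
    and "content_from i T = content_from i U"
  shows "T = U"
  using assms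
proof (induction T arbitrary: U i)
  case Nil
  then show ?case by (cases U) auto
next
  case (Cons r T)
  obtain s V where U: "U = s # V" using Cons.prems by (cases U) auto
  have row: "filter_mset (\<lambda>x. fst x = i) (content_from i (q # W)) = image_mset (Pair i) (mset q)" for q W
  proof -
    have "filter_mset (\<lambda>x. fst x = i) (content_from (Suc i) W) = {#}"
      using content_from_ge[of _ _ "Suc i" W] by fastforce
    moreover have "filter_mset (\<lambda>x. fst x = i) (image_mset (Pair i) (mset q)) = image_mset (Pair i) (mset q)"
      by (simp add: filter_mset_image_mset)
    ultimately show ?thesis by simp
  qed
  have "image_mset (Pair i) (mset r) = image_mset (Pair i) (mset s)"
    using row[of r T] row[of s V] Cons.prems(3) unfolding U by argo
  then have "mset r = mset s"
    using multiset.inj_map_strong[of "mset r" "mset s" "Pair i" "Pair i"] by simp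
  then have "r = s" using Cons.prems by (metis U list.set_intros(1) properties_for_sort sorted_sort_id)
  then show ?case using Cons U by simp
qed

text \<open>
  Row \<open>ys\<close> may stand directly below row \<open>xs\<close>: this is the shape condition and the condition on columns
  for two adjacent rows at once.
\<close>

fun strictly_below :: "nat list \<Rightarrow> nat list \<Rightarrow> bool"
  where
    "strictly_below xs [] \<longleftrightarrow> True"
  | "strictly_below [] (y # ys) \<longleftrightarrow> False"
  | "strictly_below (x # xs) (y # ys) \<longleftrightarrow> x < y \<and> strictly_below xs ys"

lemma strictly_below_iff_nth:
  "strictly_below xs ys \<longleftrightarrow> length ys \<le> length xs \<and> (\<forall>j<length ys. xs ! j < ys ! j)"
  by (induction xs ys rule: strictly_below.induct) (auto simp: nth_Cons All_less_Suc2 less_Suc_eq_0_disj split: nat.splits)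

text \<open>
  The counting form does not refer to positions, so it is additive in both rows. This is why the rowwise
  union of two tableaux, sorted, has strictly increasing columns again.
\<close>

lemma strictly_below_iff_counts:
  assumes "sorted xs" "sorted ys"
  shows "strictly_below xs ys \<longleftrightarrow>
    (\<forall>v. length (filter (\<lambda>y. y \<le> v) ys) \<le> length (filter (\<lambda>x. x < v) xs))"
  using assms
proof (induction xs ys rule: strictly_below.induct)
  case (3 x xs y ys)
  have no_ys: "filter (\<lambda>b. b \<le> v) ys = []" if "v < y" for v
    using 3(3) that by (fastforce simp: filter_empty_conv)
  have no_xs: "filter (\<lambda>a. a < v) xs = []" if "v \<le> x" for v
    using 3(2) that by (fastforce simp: filter_empty_conv)
  have IH: "strictly_below xs ys \<longleftrightarrow>
      (\<forall>v. length (filter (\<lambda>y. y \<le> v) ys) \<le> length (filter (\<lambda>x. x < v) xs))"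
    using 3 by simp
  show ?case
  proof
    assume "strictly_below (x # xs) (y # ys)"
    then show "\<forall>v. length (filter (\<lambda>b. b \<le> v) (y # ys)) \<le> length (filter (\<lambda>a. a < v) (x # xs))"
      using IH no_ys by (auto simp: le_SucI)
  next
    assume *: "\<forall>v. length (filter (\<lambda>b. b \<le> v) (y # ys)) \<le> length (filter (\<lambda>a. a < v) (x # xs))"
    \<comment> \<open>At the threshold \<open>y\<close> the lower row counts at least one entry, so the smallest upper entry is below \<open>y\<close>.\<close>
    from *[rule_format, of y] no_xs[of y] have "x < y"
      by (cases "x < y") auto
    moreover have "length (filter (\<lambda>b. b \<le> v) ys) \<le> length (filter (\<lambda>a. a < v) xs)" for v
      using *[rule_format, of v] no_ys[of v] \<open>x < y\<close> by (cases "y \<le> v") auto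
    ultimately show "strictly_below (x # xs) (y # ys)" using IH by simp
  qed
qed (auto simp: filter_empty_conv)

lemma strictly_below_sort_append:
  assumes "strictly_below r s" "strictly_below r' s'" "sorted r" "sorted s" "sorted r'" "sorted s'"
  shows "strictly_below (sort (r @ r')) (sort (s @ s'))"
proof -
  have len: "length (filter P (sort xs)) = length (filter P xs)" for P and xs :: "nat list"
    by (metis filter_sort length_sort)
  show ?thesis
    using assms by (auto simp: strictly_below_iff_counts len intro!: add_mono)
qed

lemma semistandard_iff_successively:
  "semistandard T \<longleftrightarrow>
    (\<forall>r\<in>set T. r \<noteq> [] \<and> sorted r \<and> 0 \<notin> set r) \<and> successively strictly_below T"
proof -
  have nth: "successively P T \<longleftrightarrow> (\<forall>i. Suc i < length T \<longrightarrow> P (T ! i) (T ! Suc i))"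
    for P :: "nat list \<Rightarrow> nat list \<Rightarrow> bool" and T
  proof (induction P T rule: successively.induct)
    case (3 P x y xs)
    have split: "(\<forall>i. Q i) \<longleftrightarrow> Q 0 \<and> (\<forall>i. Q (Suc i))" for Q :: "nat \<Rightarrow> bool"
      by (metis not0_implies_Suc)
    show ?case by (subst split) (simp add: 3)
  qed auto
  have "transp (\<lambda>r s :: nat list. length s \<le> length r)" by (auto intro: transpI)
  then have "sorted_wrt (\<ge>) (map length T) \<longleftrightarrow> successively (\<lambda>r s. length s \<le> length r) T"
    by (subst successively_conv_sorted_wrt) (auto simp: sorted_wrt_map)
  then show ?thesis
    unfolding semistandard_def nth strictly_below_iff_nth by blast
qed

lemma length_star: "length (T \<star> U) = max (length T) (length U)"
  by (induction T U rule: star.induct) auto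

lemma star_rows:
  assumes "\<forall>r\<in>set T. P r" "\<forall>r\<in>set U. P r" "\<And>r s. P r \<Longrightarrow> P s \<Longrightarrow> P (sort (r @ s))"
  shows "\<forall>r\<in>set (T \<star> U). P r"
  using assms(1,2) by (induction T U rule: star.induct) (auto intro: assms(3))

text \<open>
  Carrying a row above each tableau makes the induction work when one of the tableaux ends: the empty
  row then takes the place of the missing rows.
\<close>

lemma successively_star:
  assumes "\<forall>r\<in>set (r # T). sorted r" "\<forall>r\<in>set (s # U). sorted r"
    and "successively strictly_below (r # T)" "successively strictly_below (s # U)"
  shows "successively strictly_below (sort (r @ s) # (T \<star> U))"
  using assms
proof (induction T U arbitrary: r s rule: star.induct)
  case (1 U)
  then show ?case
    using strictly_below_sort_append[of r "[]" s "hd U"]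
    by (cases U) (auto simp: sorted_sort_id)
next
  case (2 t T)
  then show ?case
    using strictly_below_sort_append[of r t s "[]"]
    by (auto simp: sorted_sort_id)
next
  case (3 t T u U)
  then show ?case
    using strictly_below_sort_append[of r t s u] by auto
qed

lemma semistandard_star:
  assumes "semistandard T" "semistandard U"
  shows "semistandard (T \<star> U)"
proof -
  have "successively strictly_below (T \<star> U)"
    using assms successively_star[of "hd T" "tl T" "hd U" "tl U"]
    by (cases T; cases U) (auto simp: semistandard_iff_successively)
  moreover have "sort (r @ s) \<noteq> []" if "r \<noteq> []" for r s :: "nat list"
    using that by (metis append_is_Nil_conv length_0_conv length_sort)
  then have "\<forall>r\<in>set (T \<star> U). r \<noteq> [] \<and> sorted r \<and> 0 \<notin> set r"
    using assms by (intro star_rows) (auto simp: semistandard_def)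
  ultimately show ?thesis
    by (simp add: semistandard_iff_successively)
qed

lemma SSYT_star: "T \<in> SSYT n m \<Longrightarrow> U \<in> SSYT n m \<Longrightarrow> T \<star> U \<in> SSYT n m"
  using star_rows[of T "\<lambda>r. set r \<subseteq> {1..m}" U]
  by (simp add: SSYT_def semistandard_star length_star)

lemma content_inj: "inj_on content (SSYT n m)"
  by (rule inj_onI, rule content_from_inj) (auto simp: SSYT_def semistandard_def)

lemma Nil_in_SSYT: "[] \<in> SSYT n m"
  by (simp add: SSYT_def semistandard_def)

lemma tableau_monoid_simps [simp]:
  "carrier (tableau_monoid n m) = SSYT n m"
  "T \<otimes>\<^bsub>tableau_monoid n m\<^esub> U = T \<star> U"
  "\<one>\<^bsub>tableau_monoid n m\<^esub> = []"
  by (simp_all add: tableau_monoid_def)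

text \<open>
  All laws hold for contents, hence for tableaux.
\<close>

lemma comm_monoid_tableau_monoid: "comm_monoid (tableau_monoid n m)"
  by (rule comm_monoidI)
    (auto simp: SSYT_star Nil_in_SSYT content_star ac_simps intro!: inj_onD[OF content_inj[of n m]])


section \<open>Decomposition into columns\<close>

lemma G_eq_columns:
  "G n m = column ` {c. c \<noteq> [] \<and> length c \<le> n \<and> sorted_wrt (<) c \<and> set c \<subseteq> {1..m}}"
proof -
  have iff: "column c \<in> G n m \<longleftrightarrow> c \<noteq> [] \<and> length c \<le> n \<and> sorted_wrt (<) c \<and> set c \<subseteq> {1..m}" for c
  proof -
    have "successively strictly_below (column c) \<longleftrightarrow> sorted_wrt (<) c"
      by (simp add: column_def successively_map successively_conv_sorted_wrt)
    moreover have "0 \<notin> set c" if "set c \<subseteq> {1..m}" using that by auto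
    ultimately show ?thesis
      by (cases c) (auto simp: G_def SSYT_def semistandard_iff_successively column_def)
  qed
  have col: "T = column (map hd T)" if "T \<in> G n m" for T
  proof -
    obtain r R where T: "T = r # R" "length r = 1" "semistandard T"
      using \<open>T \<in> G n m\<close> by (cases T) (auto simp: G_def SSYT_def)
    then have "length s = 1" if "s \<in> set T" for s
      using that by (fastforce simp: semistandard_def le_Suc_eq)
    then have "[hd s] = s" if "s \<in> set T" for s
      using that by (metis One_nat_def length_0_conv length_Suc_conv list.sel(1))
    then show ?thesis by (simp add: column_def map_idI)
  qed
  show ?thesis
  proof (intro subset_antisym subsetI)
    fix T assume "T \<in> G n m"
    then show "T \<in> column ` {c. c \<noteq> [] \<and> length c \<le> n \<and> sorted_wrt (<) c \<and> set c \<subseteq> {1..m}}"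
      using col[of T] iff[of "map hd T"] by (intro image_eqI[of _ _ "map hd T"]) simp_all
  qed (auto simp: iff)
qed

lemma column_inj: "column c = column d \<longleftrightarrow> c = d"
  by (simp add: column_def inj_map_eq_map inj_def)

lemma column_in_G:
  "column c \<in> G n m \<longleftrightarrow> c \<noteq> [] \<and> length c \<le> n \<and> sorted_wrt (<) c \<and> set c \<subseteq> {1..m}"
  by (auto simp: G_eq_columns column_inj image_iff)

lemma G_columnE:
  assumes "T \<in> G n m" obtains c where "T = column c"
  using assms by (auto simp: G_eq_columns)

text \<open>
  Row lengths decrease weakly, so the first row that becomes empty is followed only by rows that become
  empty as well, and the result may stop there.
\<close>

fun remove_column :: "tableau \<Rightarrow> tableau"
  where
    "remove_column [] = []"
  | "remove_column (r # T) = (if tl r = [] then [] else tl r # remove_column T)"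

lemma remove_column_content:
  assumes "\<forall>r\<in>set T. r \<noteq> []" "successively strictly_below T"
  shows "content_from i T = content_from i (column (map hd T)) + content_from i (remove_column T)"
  using assms
proof (induction T arbitrary: i)
  case (Cons r T)
  obtain a q where r: "r = a # q" using Cons.prems by (cases r) auto
  have IH: "content_from (Suc i) T = content_from (Suc i) (column (map hd T)) + content_from (Suc i) (remove_column T)"
    using Cons by (auto simp: successively_Cons)
  show ?case
  proof (cases "q = []")
    case True
    then have "length s = 1" if "T = s # U" for s U
      using Cons.prems that by (auto simp: r strictly_below_iff_nth le_Suc_eq)
    then have "remove_column T = []" by (cases T) (auto simp: length_Suc_conv)
    then show ?thesis using True IH by (simp add: r column_def)
  next
    case False
    then show ?thesis using IH by (simp add: r column_def)
  qed
qed (simp add: column_def)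

lemma remove_column_successively:
  assumes "\<forall>r\<in>set T. r \<noteq> []" "successively strictly_below T"
  shows "successively strictly_below (remove_column T)"
  using assms
proof (induction T rule: induct_list012)
  case (3 r s T)
  then show ?case by (cases r; cases s) auto
qed auto

lemma remove_column_rows: "r \<in> set (remove_column T) \<Longrightarrow> r \<noteq> [] \<and> (\<exists>s\<in>set T. r = tl s)"
  by (induction T) (auto split: if_splits)

lemma length_remove_column: "length (remove_column T) \<le> length T"
  by (induction T) auto

lemma SSYT_remove_column:
  assumes "T \<in> SSYT n m"
  shows "remove_column T \<in> SSYT n m"
proof -
  have "set (tl s) \<subseteq> set s" for s :: "nat list" by (cases s) auto
  then show ?thesis
    using assms length_remove_column[of T]
    by (fastforce simp: SSYT_def semistandard_iff_successively sorted_tl remove_column_successively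
        dest!: remove_column_rows)
qed

lemma first_column_in_G:
  assumes "T \<in> SSYT n m" "T \<noteq> []"
  shows "column (map hd T) \<in> G n m"
proof -
  have "successively (\<lambda>r s. hd r < hd s) T" if "successively strictly_below T" "\<forall>r\<in>set T. r \<noteq> []" for T
    using that
  proof (induction T rule: induct_list012)
    case (3 r s T)
    then show ?case by (cases r; cases s) auto
  qed auto
  then have "sorted_wrt (<) (map hd T)"
    using assms by (auto simp: SSYT_def semistandard_iff_successively successively_map simp flip: successively_conv_sorted_wrt)
  then show ?thesis
    using assms by (fastforce simp: column_in_G SSYT_def semistandard_def)
qed

abbreviation total_content :: "tableau multiset \<Rightarrow> (nat \<times> nat) multiset"
  where "total_content u \<equiv> (\<Sum>T\<in>#u. content T)"

text \<open>
  Split off the first column and induct.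
\<close>

lemma column_decomposition:
  assumes "T \<in> SSYT n m"
  obtains u where "set_mset u \<subseteq> G n m" "total_content u = content T"
proof -
  have "\<exists>u. set_mset u \<subseteq> G n m \<and> total_content u = content T"
    using assms
  proof (induction "size (content T)" arbitrary: T rule: less_induct)
    case less
    show ?case
    proof (cases "T = []")
      case False
      have split: "content T = content (column (map hd T)) + content (remove_column T)"
        using less.prems by (intro remove_column_content) (auto simp: SSYT_def semistandard_iff_successively)
      have "content (column (map hd T)) \<noteq> {#}" using False by (cases T) (auto simp: column_def)
      then have "size (content (remove_column T)) < size (content T)"
        using split by (simp add: nonempty_has_size)
      from less.hyps[OF this SSYT_remove_column[OF less.prems]] obtain u
        where "set_mset u \<subseteq> G n m" "total_content u = content (remove_column T)" by auto
      then show ?thesis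
        using first_column_in_G[OF less.prems False] split
        by (intro exI[of _ "add_mset (column (map hd T)) u"]) simp
    qed (auto intro: exI[of _ "{#}"])
  qed
  then show thesis using that by auto
qed

lemma star_of_columns:
  assumes "set_mset u \<subseteq> G n m"
  obtains T where "T \<in> SSYT n m" "content T = total_content u"
proof -
  have "\<exists>T\<in>SSYT n m. content T = total_content u"
    using assms
  proof (induction u)
    case empty
    then show ?case using Nil_in_SSYT[of n m] by force
  next
    case (add x u)
    then obtain T where "T \<in> SSYT n m" "content T = total_content u" by auto
    then show ?case
      using add.prems SSYT_star[of x n m T] by (intro bexI[of _ "x \<star> T"]) (auto simp: content_star G_def)
  qed
  then show thesis using that by auto
qed

section \<open>The lattice of columns\<close>

text \<open>
  The rowwise minimum and maximum, where a column continues below its last entry with infinite entries: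
  the meet has the length of the longer column and the join that of the shorter one.
\<close>

fun column_meet :: "nat list \<Rightarrow> nat list \<Rightarrow> nat list"
  where
    "column_meet [] d = d"
  | "column_meet c [] = c"
  | "column_meet (a # c) (b # d) = min a b # column_meet c d"

fun column_join :: "nat list \<Rightarrow> nat list \<Rightarrow> nat list"
  where
    "column_join [] d = []"
  | "column_join c [] = []"
  | "column_join (a # c) (b # d) = max a b # column_join c d"

fun column_le :: "nat list \<Rightarrow> nat list \<Rightarrow> bool"
  where
    "column_le c [] \<longleftrightarrow> True"
  | "column_le [] (b # d) \<longleftrightarrow> False"
  | "column_le (a # c) (b # d) \<longleftrightarrow> a \<le> b \<and> column_le c d"

lemma column_le_iff_nth:
  "column_le c d \<longleftrightarrow> length d \<le> length c \<and> (\<forall>k<length d. c ! k \<le> d ! k)"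
  by (induction c d rule: column_le.induct)
     (auto simp: nth_Cons All_less_Suc2 less_Suc_eq_0_disj split: nat.splits)

lemma column_le_trans: "column_le c d \<Longrightarrow> column_le d e \<Longrightarrow> column_le c e"
  unfolding column_le_iff_nth by (meson order_trans less_le_trans)

lemma column_le_refl: "column_le c c"
  by (simp add: column_le_iff_nth)

lemma column_le_antisym: "column_le c d \<Longrightarrow> column_le d c \<Longrightarrow> c = d"
  by (auto simp: column_le_iff_nth intro!: nth_equalityI antisym)

lemma column_meet_le: "column_le (column_meet c d) c" "column_le (column_meet c d) d"
  by (induction c d rule: column_meet.induct) (auto simp: column_le_refl)

lemma column_le_join: "column_le c (column_join c d)" "column_le d (column_join c d)"
  by (induction c d rule: column_join.induct) (auto simp: column_le_refl)

lemma meet_join_of_le: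
  "column_le c d \<Longrightarrow> column_meet c d = c \<and> column_join c d = d"
  "column_le d c \<Longrightarrow> column_meet c d = d \<and> column_join c d = c"
proof -
  have Nil: "column_meet c [] = c" "column_join c [] = []" for c
    by (cases c; simp)+
  show "column_le c d \<Longrightarrow> column_meet c d = c \<and> column_join c d = d"
    by (induction c d rule: column_le.induct) (auto simp: Nil)
  show "column_le d c \<Longrightarrow> column_meet c d = d \<and> column_join c d = c"
    by (induction d c rule: column_le.induct) (auto simp: Nil)
qed

text \<open>
  In each row the two entries are permuted.
\<close>

lemma content_meet_join:
  "content_from i (column (column_meet c d)) + content_from i (column (column_join c d)) =
    content_from i (column c) + content_from i (column d)"
  by (induction c d arbitrary: i rule: column_meet.induct)
     (auto simp: column_def min_def max_def)

lemma set_column_meet: "set (column_meet c d) \<subseteq> set c \<union> set d"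
  by (induction c d rule: column_meet.induct) (auto simp: min_def)

lemma set_column_join:
  "x \<in> set (column_join c d) \<Longrightarrow> (x \<in> set c \<or> x \<in> set d) \<and> (\<exists>y\<in>set c. y \<le> x) \<and> (\<exists>y\<in>set d. y \<le> x)"
  by (induction c d rule: column_join.induct) (auto simp: max_def split: if_splits)

lemma sorted_column_meet:
  "sorted_wrt (<) c \<Longrightarrow> sorted_wrt (<) d \<Longrightarrow> sorted_wrt (<) (column_meet c d)"
  by (induction c d rule: column_meet.induct) (use set_column_meet in \<open>fastforce simp: min_def\<close>)+

text \<open>
  Every later entry of the join is at least some later entry of each of the two columns, and so exceeds
  both current entries.
\<close>

lemma sorted_column_join:
  "sorted_wrt (<) c \<Longrightarrow> sorted_wrt (<) d \<Longrightarrow> sorted_wrt (<) (column_join c d)"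
  by (induction c d rule: column_join.induct) (auto dest!: set_column_join)

lemma length_column_meet_join:
  "length (column_meet c d) = max (length c) (length d)"
  "length (column_join c d) = min (length c) (length d)"
  by (induction c d rule: column_meet.induct) auto

lemma meet_join_in_G:
  assumes "column c \<in> G n m" "column d \<in> G n m"
  shows "column (column_meet c d) \<in> G n m" "column (column_join c d) \<in> G n m"
proof -
  have "column_meet c d \<noteq> []" "column_join c d \<noteq> []"
    using assms by (cases c; cases d; simp add: column_in_G)+
  moreover have "set (column_meet c d) \<subseteq> {1..m}" "set (column_join c d) \<subseteq> {1..m}"
    using assms set_column_meet[of c d] set_column_join[of _ c d] unfolding column_in_G by blast+
  ultimately show "column (column_meet c d) \<in> G n m" "column (column_join c d) \<in> G n m"
    using assms
    by (auto simp: column_in_G length_column_meet_join sorted_column_meet sorted_column_join)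
qed


section \<open>Straightening\<close>

definition product_relation :: "nat \<Rightarrow> nat \<Rightarrow> tableau \<Rightarrow> tableau \<Rightarrow> tableau \<Rightarrow> tableau \<Rightarrow> bool"
  where "product_relation n m T1 T2 T3 T4 \<longleftrightarrow>
    {T1, T2, T3, T4} \<subseteq> G n m \<and> distinct [T1, T2, T3, T4] \<and> T1 \<star> T2 = T3 \<star> T4"

text \<open>
  Equality of monomials modulo the product relations, on the level of multisets of columns.
\<close>

inductive product_equivalent :: "nat \<Rightarrow> nat \<Rightarrow> tableau multiset \<Rightarrow> tableau multiset \<Rightarrow> bool"
  for n m
  where
    refl: "product_equivalent n m u u"
  | sym: "product_equivalent n m u v \<Longrightarrow> product_equivalent n m v u"
  | trans: "product_equivalent n m u v \<Longrightarrow> product_equivalent n m v w \<Longrightarrow> product_equivalent n m u w"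
  | exchange: "product_relation n m T1 T2 T3 T4 \<Longrightarrow> set_mset u \<subseteq> G n m \<Longrightarrow>
      product_equivalent n m ({#T1, T2#} + u) ({#T3, T4#} + u)"

lemma product_equivalent_content:
  "product_equivalent n m u v \<Longrightarrow> total_content u = total_content v"
proof (induction rule: product_equivalent.induct)
  case (exchange T1 T2 T3 T4 u)
  then have "content (T1 \<star> T2) = content (T3 \<star> T4)" by (simp add: product_relation_def)
  then show ?case by (simp add: content_star flip: add.assoc)
qed auto

lemma product_equivalent_add:
  "product_equivalent n m u v \<Longrightarrow> T \<in> G n m \<Longrightarrow> product_equivalent n m (add_mset T u) (add_mset T v)"
proof (induction rule: product_equivalent.induct)
  case (exchange T1 T2 T3 T4 u)
  then show ?case
    using product_equivalent.exchange[of n m T1 T2 T3 T4 "add_mset T u"] by (simp add: add_mset_commute)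
qed (auto intro: product_equivalent.intros)

text \<open>
  For comparable columns meet and join are the two columns themselves; for incomparable ones the four
  columns are distinct and form a product relation.
\<close>

lemma meet_join_equivalent:
  assumes "column c \<in> G n m" "column d \<in> G n m" "set_mset u \<subseteq> G n m"
  shows "product_equivalent n m ({#column c, column d#} + u)
    ({#column (column_meet c d), column (column_join c d)#} + u)"
proof (cases "column_le c d \<or> column_le d c")
  case True
  then have "{#column c, column d#} = {#column (column_meet c d), column (column_join c d)#}"
    using meet_join_of_le(1)[of c d] meet_join_of_le(2)[of d c] by auto
  then show ?thesis by (metis product_equivalent.refl)
next
  case False
  then have "distinct [column c, column d, column (column_meet c d), column (column_join c d)]"
    using column_meet_le[of c d] column_le_join(1)[of c d] column_le_join(2)[of d c] column_le_refl
    by (auto simp: column_inj dest: column_le_trans)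
  moreover have "column c \<star> column d = column (column_meet c d) \<star> column (column_join c d)"
    using assms meet_join_in_G[of c n m d]
    by (intro inj_onD[OF content_inj[of n m]])
       (simp_all add: content_star content_meet_join, simp_all add: SSYT_star G_def)
  ultimately have "product_relation n m (column c) (column d) (column (column_meet c d)) (column (column_join c d))"
    using assms meet_join_in_G[of c n m d] by (simp add: product_relation_def)
  then show ?thesis using assms(3) by (rule product_equivalent.exchange)
qed

text \<open>
  Adding a column \<open>d\<close> to a multiset with least column \<open>c\<close>, replace \<open>d\<close> and \<open>c\<close> by their meet, which is
  below everything, and their join, which is above \<open>c\<close> and so above the meet.
\<close>

lemma extract_least_column:
  assumes "set_mset u \<subseteq> G n m" "u \<noteq> {#}"
  obtains c v where "product_equivalent n m u (add_mset (column c) v)"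
    "column c \<in> G n m" "set_mset v \<subseteq> G n m" "\<And>d. column d \<in># v \<Longrightarrow> column_le c d"
proof -
  have "\<exists>c v. product_equivalent n m u (add_mset (column c) v) \<and>
    column c \<in> G n m \<and> set_mset v \<subseteq> G n m \<and> (\<forall>d. column d \<in># v \<longrightarrow> column_le c d)"
    using assms
  proof (induction u)
    case (add T u)
    obtain d where T: "T = column d" using add.prems G_columnE[of T n m] by auto
    show ?case
    proof (cases "u = {#}")
      case True
      then show ?thesis
        using add.prems T by (intro exI[of _ d] exI[of _ "{#}"]) (auto intro: product_equivalent.refl)
    next
      case False
      then obtain c v where cv: "product_equivalent n m u (add_mset (column c) v)"
        "column c \<in> G n m" "set_mset v \<subseteq> G n m" "\<forall>d. column d \<in># v \<longrightarrow> column_le c d"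
        using add by auto
      have d: "column d \<in> G n m" using add.prems T by simp
      let ?v = "add_mset (column (column_join d c)) v"
      have "product_equivalent n m (add_mset T u) ({#column d, column c#} + v)"
        using product_equivalent_add[OF cv(1) d] T by simp
      from product_equivalent.trans[OF this meet_join_equivalent[OF d cv(2,3)]]
      have "product_equivalent n m (add_mset T u) (add_mset (column (column_meet d c)) ?v)" by simp
      moreover have "column_le (column_meet d c) e" if "column e \<in># ?v" for e
        using that cv(4) column_meet_le[of d c] column_le_join(1)[of d c] column_le_join(2)[of c d]
        by (auto simp: column_inj intro: column_le_trans)
      ultimately show ?thesis
        using meet_join_in_G[OF d cv(2)] cv(3) by (intro exI[of _ "column_meet d c"] exI[of _ ?v]) auto
    qed
  qed simp
  then show thesis using that by blast
qed

lemma in_total_content: "x \<in># total_content u \<longleftrightarrow> (\<exists>T\<in>#u. x \<in># content T)"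
  by (induction u) auto

text \<open>
  The least column is determined by the content: its entry in row \<open>k\<close> is the smallest entry that occurs in
  row \<open>k\<close> anywhere. Each entry of \<open>d\<close> occurs in some column on the other side, all of which lie above \<open>c\<close>.
\<close>

lemma least_column_le:
  assumes "total_content (add_mset (column c) u) = total_content (add_mset (column d) v)"
    and "set_mset u \<subseteq> G n m" "\<And>e. column e \<in># u \<Longrightarrow> column_le c e"
  shows "column_le c d"
  unfolding column_le_iff_nth
proof -
  have key: "k < length c \<and> c ! k \<le> d ! k" if "k < length d" for k
  proof -
    have "(k, d ! k) \<in># total_content (add_mset (column c) u)"
      unfolding assms(1) using that by (simp add: in_content_column)
    then obtain T where T: "T \<in># add_mset (column c) u" "(k, d ! k) \<in># content T"
      unfolding in_total_content by auto
    obtain e where e: "T = column e" using T(1) assms(2) by (auto elim: G_columnE)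
    have "column_le c e" using T(1) assms(3) e by (auto simp: column_inj column_le_refl)
    then show ?thesis using T(2) by (auto simp: e in_content_column column_le_iff_nth)
  qed
  show "length d \<le> length c \<and> (\<forall>k<length d. c ! k \<le> d ! k)"
    using key key[of "length c"] by (meson not_le less_irrefl)
qed

text \<open>
  Both multisets can be exchanged for ones with a least column. These least columns agree; after
  splitting them off, the remaining multisets have equal contents again, and smaller ones.
\<close>

lemma product_equivalent_if_content_eq:
  assumes "set_mset u \<subseteq> G n m" "set_mset v \<subseteq> G n m" "total_content u = total_content v"
  shows "product_equivalent n m u v"
  using assms
proof (induction "size (total_content u)" arbitrary: u v rule: less_induct)
  case less
  have nonempty: "content T \<noteq> {#}" if "T \<in> G n m" for T
    using that by (cases T) (auto simp: G_def)
  show ?case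
  proof (cases "u = {#}")
    case True
    then have "v = {#}" using less.prems nonempty by (cases v) auto
    then show ?thesis using True by (simp add: product_equivalent.refl)
  next
    case False
    then have "v \<noteq> {#}" using less.prems nonempty by (cases u) auto
    obtain c u' where u': "product_equivalent n m u (add_mset (column c) u')"
      "column c \<in> G n m" "set_mset u' \<subseteq> G n m" "\<And>d. column d \<in># u' \<Longrightarrow> column_le c d"
      using extract_least_column[OF less.prems(1) False] by metis
    obtain d v' where v': "product_equivalent n m v (add_mset (column d) v')"
      "column d \<in> G n m" "set_mset v' \<subseteq> G n m" "\<And>c. column c \<in># v' \<Longrightarrow> column_le d c"
      using extract_least_column[OF less.prems(2) \<open>v \<noteq> {#}\<close>] by metis
    have eq: "total_content (add_mset (column c) u') = total_content (add_mset (column d) v')"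
      using product_equivalent_content[OF u'(1)] product_equivalent_content[OF v'(1)] less.prems(3) by simp
    have "c = d"
      using least_column_le[OF eq u'(3,4)] least_column_le[OF eq[symmetric] v'(3,4)]
      by (rule column_le_antisym)
    have smaller: "size (total_content u') < size (total_content u)"
      using product_equivalent_content[OF u'(1)] nonempty[OF u'(2)] by (simp add: nonempty_has_size)
    have "total_content u' = total_content v'" using eq \<open>c = d\<close> by simp
    with less.hyps[OF smaller u'(3) v'(3)] have "product_equivalent n m u' v'" .
    then have "product_equivalent n m (add_mset (column c) u') (add_mset (column d) v')"
      using product_equivalent_add u'(2) \<open>c = d\<close> by simp
    then show ?thesis using u'(1) v'(1) by (blast intro: product_equivalent.intros)
  qed
qed

section \<open>Product relations avoid the extremal columns\<close>

text \<open>
  There are only \<open>Suc k\<close> positive integers up to \<open>c ! k\<close>, and the first \<open>Suc k\<close> entries exhaust them.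
\<close>

lemma initial_segment:
  assumes "sorted_wrt (<) c" "0 \<notin> set c" "k < length c" "c ! k = Suc k"
  shows "take (Suc k) c = [1..<Suc (Suc k)]"
proof (rule strict_sorted_equal)
  have "set (take (Suc k) c) \<subseteq> {1..<Suc (Suc k)}"
  proof
    fix x assume "x \<in> set (take (Suc k) c)"
    then obtain j where "j \<le> k" "x = c ! j" using assms(3) by (auto simp: in_set_conv_nth less_Suc_eq_le)
    then have "x \<le> Suc k"
      using assms(3,4) sorted_wrt_nth_less[OF assms(1), of j k] by (cases "j = k") auto
    moreover have "x \<in> set c" using \<open>j \<le> k\<close> \<open>x = c ! j\<close> assms(3) by simp
    ultimately show "x \<in> {1..<Suc (Suc k)}" using assms(2) by (cases x) auto
  qed
  moreover have "card (set (take (Suc k) c)) = Suc k"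
    using assms by (simp add: distinct_card strict_sorted_iff min_def)
  ultimately show "set (take (Suc k) c) = set [1..<Suc (Suc k)]"
    by (simp add: card_subset_eq del: upt_Suc)
qed (use assms in \<open>simp_all add: sorted_wrt_take del: upt_Suc\<close>)

lemma content_max_entry:
  assumes "column c \<in> G n m" "(0, m) \<in># content (column c)"
  shows "c = [m]"
proof -
  obtain d where c: "c = m # d" using assms(2) by (cases c) (auto simp: in_content_column)
  then show ?thesis using assms(1) by (cases d) (auto simp: column_in_G)
qed

lemma content_full_column:
  assumes "column c \<in> G n m" "(n - 1, n) \<in># content (column c)"
  shows "c = [1..<Suc n]"
proof -
  have c: "n - 1 < length c" "c ! (n - 1) = n" "length c \<le> n" "sorted_wrt (<) c" "0 \<notin> set c"
    using assms by (auto simp: in_content_column column_in_G)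
  then have "take n c = [1..<Suc n]" using initial_segment[of c "n - 1"] by (cases n) (auto simp del: upt_Suc)
  then show ?thesis using c by simp
qed

text \<open>
  The first \<open>n - 1\<close> entries are \<open>1, \<dots>, n - 1\<close>; a further entry can only be \<open>n\<close>, as the entries are
  bounded by \<open>n\<close>.
\<close>

lemma content_almost_full_column:
  assumes "column c \<in> G n n" "1 < n" "(n - 2, n - 1) \<in># content (column c)"
  shows "c = [1..<n] \<or> c = [1..<Suc n]"
proof -
  have c: "n - 2 < length c" "c ! (n - 2) = n - 1" "length c \<le> n" "sorted_wrt (<) c" "set c \<subseteq> {1..n}" "0 \<notin> set c"
    using assms by (auto simp: in_content_column column_in_G)
  obtain k where n: "n = Suc (Suc k)" using less_imp_Suc_add[OF assms(2)] by auto
  have t: "take (n - 1) c = [1..<n]" using initial_segment[of c "n - 2"] c by (simp add: n del: upt_Suc)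
  show ?thesis
  proof (cases "length c = n")
    case True
    then have "c ! (n - 1) \<in> set c" by (simp add: n)
    then have "c ! (n - 1) \<le> n" using c(5) by auto
    moreover have "c ! (n - 1) > n - 1"
      using True c(2) sorted_wrt_nth_less[OF c(4), of "n - 2" "n - 1"] by (simp add: n)
    ultimately have "(n - 1, n) \<in># content (column c)" using True by (auto simp: in_content_column n)
    then show ?thesis using content_full_column assms(1) by blast
  next
    case False
    then show ?thesis using t c by (simp add: n)
  qed
qed

text \<open>
  Both sides of the relation have the same cells. If \<open>T1\<close> is in \<open>F\<close>, one of its cells determines the
  column that contains it, or for \<open>T1 = [1, \<dots>, n - 1]\<close> leaves only the choice between
  \<open>[1, \<dots>, n - 1]\<close> and \<open>[1, \<dots>, n]\<close>. So either \<open>T1\<close> or \<open>[1, \<dots>, n]\<close> occurs on the other side. The full column cannot occur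
  at all, since it would then occur on both sides.
\<close>

lemma product_relation_not_F:
  assumes "0 < n" "n \<le> m" "product_relation n m T1 T2 T3 T4"
  shows "T1 \<notin> F n m"
proof
  assume T1: "T1 \<in> F n m"
  have G: "T1 \<in> G n m" "T2 \<in> G n m" "T3 \<in> G n m" "T4 \<in> G n m"
    and dist: "distinct [T1, T2, T3, T4]" and eq: "T1 \<star> T2 = T3 \<star> T4"
    using assms(3) by (auto simp: product_relation_def)
  have cont: "content T1 + content T2 = content T3 + content T4"
    using arg_cong[OF eq, of content] by (simp add: content_star)
  have mem: "x \<in># content T1 \<or> x \<in># content T2 \<longleftrightarrow> x \<in># content T3 \<or> x \<in># content T4" for x
    by (simp only: cont flip: union_iff)
  have full_eq: "T = column [1..<Suc n]" if "T \<in> {T1, T2, T3, T4}" "(n - 1, n) \<in># content T" for T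
  proof -
    have "T \<in> G n m" using that(1) G by auto
    then obtain c where "T = column c" by (rule G_columnE)
    then show ?thesis using content_full_column[of c n m] \<open>T \<in> G n m\<close> that(2) by simp
  qed
  have full: False if "column [1..<Suc n] \<in> {T1, T2, T3, T4}"
  proof -
    have "(n - 1, n) \<in># content (column [1..<Suc n])"
      using assms(1) by (auto simp: in_content_column simp del: upt_Suc)
    then have "((n - 1, n) \<in># content T1 \<or> (n - 1, n) \<in># content T2) \<and>
        ((n - 1, n) \<in># content T3 \<or> (n - 1, n) \<in># content T4)"
      using that mem[of "(n - 1, n)"] by auto
    then have "(T1 = column [1..<Suc n] \<or> T2 = column [1..<Suc n]) \<and>
        (T3 = column [1..<Suc n] \<or> T4 = column [1..<Suc n])"
      using full_eq[of T1] full_eq[of T2] full_eq[of T3] full_eq[of T4] by blast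
    then show False using dist by auto
  qed
  have max: False if "T1 = column [m]"
  proof -
    have "(0, m) \<in># content T1" by (simp add: that in_content_column)
    then obtain T where T: "T \<in> {T3, T4}" "(0, m) \<in># content T" using mem[of "(0, m)"] by auto
    have "T \<in> G n m" using T(1) G by auto
    then obtain c where "T = column c" by (rule G_columnE)
    then have "T = T1" using content_max_entry[of c n m] \<open>T \<in> G n m\<close> T(2) that by simp
    then show False using T(1) dist by auto
  qed
  have almost: False if "T1 = column [1..<n]" "1 < n" "m = n"
  proof -
    have "(n - 2, n - 1) \<in># content T1" using that(2) by (auto simp: that(1) in_content_column)
    then obtain T where T: "T \<in> {T3, T4}" "(n - 2, n - 1) \<in># content T"
      using mem[of "(n - 2, n - 1)"] by auto
    have "T \<in> G n n" using T(1) G that(3) by auto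
    then obtain c where "T = column c" by (rule G_columnE)
    then have "T = T1 \<or> T = column [1..<Suc n]"
      using content_almost_full_column[of c n] \<open>T \<in> G n n\<close> T(2) that by auto
    then show False using T(1) full dist by auto
  qed
  have "T1 \<noteq> []" using G(1) by (simp add: G_def)
  then have "1 < n" if "T1 = column [1..<n]"
    using that by (cases "n = 1") (use assms(1) in \<open>auto simp: column_def\<close>)
  then show False
    using T1 full max almost by (auto simp: F_def split: if_splits)
qed

text \<open>
  The relation is symmetric under exchanging the factors and the sides, so what holds for the first
  column holds for all four.
\<close>

lemma product_relation_in_E:
  assumes "0 < n" "n \<le> m" "product_relation n m T1 T2 T3 T4"
  shows "{T1, T2, T3, T4} \<subseteq> E n m"
proof -
  have comm: "S \<star> T = T \<star> S" if "S \<in> G n m" "T \<in> G n m" for S T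
    using comm_monoid.m_comm[OF comm_monoid_tableau_monoid[of n m], of S T] that by (simp add: G_def)
  have "product_relation n m T2 T1 T3 T4" "product_relation n m T3 T4 T1 T2" "product_relation n m T4 T3 T1 T2"
    using assms(3) comm by (auto simp: product_relation_def)
  then have "{T1, T2, T3, T4} \<inter> F n m = {}"
    using assms(3) product_relation_not_F[OF assms(1,2)] by blast
  then show ?thesis
    using assms(3) by (auto simp: E_def product_relation_def)
qed

lemma F_subset_G:
  assumes "0 < n" "n \<le> m"
  shows "F n m \<subseteq> G n m"
proof -
  have "column [m] \<in> G n m" "column [1..<Suc n] \<in> G n m" "n \<noteq> 1 \<Longrightarrow> column [1..<n] \<in> G n m"
    using assms by (auto simp: column_in_G simp del: upt_Suc)
  moreover have "column [1..<n] = []" if "n = 1" using that by (simp add: column_def)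
  ultimately show ?thesis by (cases "n = 1") (auto simp: F_def simp del: upt_Suc)
qed

section \<open>Evaluation in an integral domain\<close>

text \<open>
  Encoding the cells by natural numbers turns contents into exponents of type
  \<^typ>\<open>nat \<Rightarrow>\<^sub>0 nat\<close>. These carry a linear order that is compatible with addition, so the
  polynomials with such exponents form an integral domain.
\<close>

definition exponent :: "(nat \<times> nat) multiset \<Rightarrow> (nat \<Rightarrow>\<^sub>0 nat)"
  where "exponent M = (\<Sum>x\<in>#M. Poly_Mapping.single (prod_encode x) 1)"

lemma exponent_add: "exponent (M + N) = exponent M + exponent N"
  by (simp add: exponent_def)

lemma exponent_empty: "exponent {#} = 0"
  by (simp add: exponent_def)

lemma inj_exponent: "inj exponent"
proof (rule injI)
  have "Poly_Mapping.lookup (exponent M) (prod_encode x) = count M x" for M x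
    by (induction M)
      (auto simp: exponent_def lookup_add lookup_single when_def dest: injD[OF inj_prod_encode])
  then show "M = N" if "exponent M = exponent N" for M N
    using that by (metis multiset_eqI)
qed

definition exponent_monoid :: "(nat \<Rightarrow>\<^sub>0 nat) monoid"
  where "exponent_monoid = \<lparr>carrier = UNIV, mult = (+), one = 0\<rparr>"

lemma exponent_monoid_simps [simp]:
  "carrier exponent_monoid = UNIV" "a \<otimes>\<^bsub>exponent_monoid\<^esub> b = a + b" "\<one>\<^bsub>exponent_monoid\<^esub> = 0"
  by (simp_all add: exponent_monoid_def)

lemma comm_monoid_exponent_monoid: "comm_monoid exponent_monoid"
  by (rule comm_monoidI) (auto simp: ac_simps)

text \<open>
  The product of the monoid algebra agrees with the product of the type of polynomials, which has no
  zero divisors.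
\<close>

lemma domain_exponent_algebra:
  "domain (monoid_algebra exponent_monoid :: ('k::field, _) module)"
proof (intro domain.intro domain_axioms.intro)
  let ?R = "monoid_algebra exponent_monoid :: ('k, _) module"
  show "cring ?R" by (rule comm_monoid.cring_monoid_algebra[OF comm_monoid_exponent_monoid])
  have mult: "p \<otimes>\<^bsub>?R\<^esub> q = p * q" for p q
  proof -
    have single: "Poly_Mapping.single a c \<otimes>\<^bsub>?R\<^esub> q = Poly_Mapping.single a c * q" for a c q
      by (rule span_induct[where S = UNIV and p = q])
        (simp_all add: monoid_algebra_mult_bilinear mult_single distrib_left)
    show ?thesis
      by (rule span_induct[where S = UNIV and p = p])
        (simp_all add: monoid_algebra_mult_bilinear single distrib_right)
  qed
  show "\<one>\<^bsub>?R\<^esub> \<noteq> \<zero>\<^bsub>?R\<^esub>" by (simp flip: keys_eq_empty)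
  show "p = \<zero>\<^bsub>?R\<^esub> \<or> q = \<zero>\<^bsub>?R\<^esub>" if "p \<otimes>\<^bsub>?R\<^esub> q = \<zero>\<^bsub>?R\<^esub>" for p q
    using that unfolding mult by simp
qed


definition poly_value :: "'k::field tableau_poly \<Rightarrow> ((nat \<Rightarrow>\<^sub>0 nat) \<Rightarrow>\<^sub>0 'k)"
  where "poly_value = basis_map (\<lambda>u. exponent (total_content u))"

definition tableau_value :: "(tableau \<Rightarrow>\<^sub>0 'k::field) \<Rightarrow> ((nat \<Rightarrow>\<^sub>0 nat) \<Rightarrow>\<^sub>0 'k)"
  where "tableau_value = basis_map (\<lambda>T. exponent (content T))"

lemma poly_value_ring_hom:
  "poly_value \<in> ring_hom (polynomial_algebra Y) (monoid_algebra exponent_monoid :: ('k::field, _) module)"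
  unfolding poly_value_def polynomial_algebra_def
  by (rule basis_map_ring_hom)
     (auto simp: comm_monoid_monomial_monoid comm_monoid_exponent_monoid hom_def exponent_add exponent_empty)

lemma tableau_value_ring_hom:
  "tableau_value \<in> ring_hom (tableaux_algebra n m) (monoid_algebra exponent_monoid :: ('k::field, _) module)"
  unfolding tableau_value_def tableaux_algebra_def
  by (rule basis_map_ring_hom)
     (auto simp: comm_monoid_tableau_monoid comm_monoid_exponent_monoid hom_def exponent_add exponent_empty content_star)

lemma tableau_value_inj: "inj_on tableau_value {p. Poly_Mapping.keys p \<subseteq> SSYT n m}"
  unfolding tableau_value_def
  by (rule basis_map_inj_on) (use content_inj inj_exponent in \<open>auto simp: inj_on_def\<close>)

lemma prime_kernel:
  assumes "cring R" "domain S" "h \<in> ring_hom R S"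
  shows "primeideal {r \<in> carrier R. h r = \<zero>\<^bsub>S\<^esub>} R"
proof -
  interpret S: "domain" S by fact
  interpret R: cring R by fact
  interpret ring_hom_ring R S h by (rule ring_hom_ringI2[OF R.ring_axioms S.ring_axioms assms(3)])
  show ?thesis using primeideal_vimage[OF assms(1) S.zeroprimeideal] by simp
qed

lemma tableaux_algebra_zero_prime:
  "primeideal {\<zero>\<^bsub>tableaux_algebra n m\<^esub>} (tableaux_algebra n m :: ('k::field, _) module)"
proof -
  let ?T = "tableaux_algebra n m :: ('k::field, _) module"
  have cr: "cring ?T"
    unfolding tableaux_algebra_def by (rule comm_monoid.cring_monoid_algebra[OF comm_monoid_tableau_monoid])
  have "{p \<in> carrier ?T. tableau_value p = \<zero>\<^bsub>monoid_algebra exponent_monoid\<^esub>} = {\<zero>\<^bsub>?T\<^esub>}"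
    using inj_onD[OF tableau_value_inj, of _ 0 n m] by (auto simp: tableaux_algebra_def tableau_value_def)
  then show ?thesis
    using prime_kernel[OF cr domain_exponent_algebra tableau_value_ring_hom] by simp
qed

text \<open>
  A product of columns in the tableau monoid has the total content of its factors.
\<close>

lemma tableau_value_tableau_map:
  assumes "Poly_Mapping.keys p \<subseteq> {u. set_mset u \<subseteq> G n m}"
  shows "tableau_value (tableau_map n m p) = poly_value p"
    "Poly_Mapping.keys (tableau_map n m p) \<subseteq> SSYT n m"
proof -
  interpret comm_monoid "tableau_monoid n m" by (rule comm_monoid_tableau_monoid)
  define prd where "prd u = (\<Otimes>\<^bsub>tableau_monoid n m\<^esub>T\<in>set_mset u. T [^]\<^bsub>tableau_monoid n m\<^esub> count u T)" for u
  have pow: "T [^]\<^bsub>tableau_monoid n m\<^esub> k \<in> SSYT n m \<and>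
      content (T [^]\<^bsub>tableau_monoid n m\<^esub> k) = repeat_mset k (content T)"
    if "T \<in> G n m" for T and k :: nat
    using that
    by (induction k) (auto simp: G_def Nil_in_SSYT content_star SSYT_star)
  have prd: "prd u \<in> SSYT n m \<and> content (prd u) = total_content u" if u: "set_mset u \<subseteq> G n m" for u
  proof -
    have fin: "(\<Otimes>\<^bsub>tableau_monoid n m\<^esub>T\<in>A. T [^]\<^bsub>tableau_monoid n m\<^esub> count u T) \<in> SSYT n m \<and>
        content (\<Otimes>\<^bsub>tableau_monoid n m\<^esub>T\<in>A. T [^]\<^bsub>tableau_monoid n m\<^esub> count u T) =
          (\<Sum>T\<in>A. repeat_mset (count u T) (content T))"
      if "finite A" "A \<subseteq> G n m" for A
      using that
    proof (induction A rule: finite_induct)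
      case (insert T A)
      then show ?case
        using pow by (subst (1 2) finprod_insert) (auto simp: Pi_def content_star SSYT_star)
    qed (simp add: Nil_in_SSYT)
    \<comment> \<open>The summation range stays fixed while the induction changes the multiset.\<close>
    have "total_content v = (\<Sum>T\<in>set_mset u. repeat_mset (count v T) (content T))"
      if "set_mset v \<subseteq> set_mset u" for v
      using that
    proof (induction v)
      case (add T v)
      have "(\<Sum>S\<in>set_mset u. repeat_mset (count (add_mset T v) S) (content S)) =
          (\<Sum>S\<in>set_mset u. (if S = T then content S else {#}) + repeat_mset (count v S) (content S))"
        by (rule sum.cong) auto
      then show ?case using add by (simp add: sum.distrib)
    qed simp
    then show ?thesis using fin[OF finite_set_mset u] by (simp add: prd_def)
  qed
  have map: "tableau_map n m p = basis_map prd p"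
    by (simp add: tableau_map_def basis_map_def lin_ext_def prd_def)
  show "Poly_Mapping.keys (tableau_map n m p) \<subseteq> SSYT n m"
    unfolding map basis_map_def by (rule keys_lin_ext) (use prd assms in auto)
  show "tableau_value (tableau_map n m p) = poly_value p"
    unfolding map tableau_value_def basis_map_basis_map poly_value_def
    by (rule basis_map_cong) (use prd assms in auto)
qed

section \<open>Tensor products of quotients of monoid algebras\<close>

lemma comm_monoid_DirProd:
  assumes "comm_monoid M" "comm_monoid N"
  shows "comm_monoid (M \<times>\<times> N)"
proof -
  interpret M: comm_monoid M by fact
  interpret N: comm_monoid N by fact
  show ?thesis
    by (rule comm_monoidI) (auto simp: DirProd_def M.m_ac N.m_ac)
qed

lemma DirProd_simps [simp]:
  "carrier (M \<times>\<times> N) = carrier M \<times> carrier N"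
  "(a, b) \<otimes>\<^bsub>M \<times>\<times> N\<^esub> (a', b') = (a \<otimes>\<^bsub>M\<^esub> a', b \<otimes>\<^bsub>N\<^esub> b')"
  "\<one>\<^bsub>M \<times>\<times> N\<^esub> = (\<one>\<^bsub>M\<^esub>, \<one>\<^bsub>N\<^esub>)"
  by (simp_all add: DirProd_def)

lemma bilinearity_relationsI:
  "a \<in> carrier A \<Longrightarrow> a' \<in> carrier A \<Longrightarrow> b \<in> carrier B \<Longrightarrow>
    Poly_Mapping.single (a \<oplus>\<^bsub>A\<^esub> a', b) 1 - Poly_Mapping.single (a, b) 1 - Poly_Mapping.single (a', b) 1
      \<in> bilinearity_relations A B"
  "a \<in> carrier A \<Longrightarrow> b \<in> carrier B \<Longrightarrow> b' \<in> carrier B \<Longrightarrow>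
    Poly_Mapping.single (a, b \<oplus>\<^bsub>B\<^esub> b') 1 - Poly_Mapping.single (a, b) 1 - Poly_Mapping.single (a, b') 1
      \<in> bilinearity_relations A B"
  "a \<in> carrier A \<Longrightarrow> b \<in> carrier B \<Longrightarrow>
    Poly_Mapping.single (c \<odot>\<^bsub>A\<^esub> a, b) 1 - Poly_Mapping.single (a, b) c \<in> bilinearity_relations A B"
  "a \<in> carrier A \<Longrightarrow> b \<in> carrier B \<Longrightarrow>
    Poly_Mapping.single (a, c \<odot>\<^bsub>B\<^esub> b) 1 - Poly_Mapping.single (a, b) c \<in> bilinearity_relations A B"
proof (unfold bilinearity_relations_def, goal_cases)
  case 1
  then show ?case
    by - (rule UnI1, rule UnI1, rule UnI1, rule CollectI, intro exI conjI, rule HOL.refl, assumption+)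
next
  case 2
  then show ?case
    by - (rule UnI1, rule UnI1, rule UnI2, rule CollectI, intro exI conjI, rule HOL.refl, assumption+)
next
  case 3
  then show ?case
    by - (rule UnI1, rule UnI2, rule CollectI, intro exI conjI, rule HOL.refl, assumption+)
next
  case 4
  then show ?case
    by - (rule UnI2, rule CollectI, intro exI conjI, rule HOL.refl, assumption+)
qed

lemma bilinearity_relations_closed:
  fixes A :: "('k::field, 'a) module" and B :: "('k, 'b) module"
  assumes "cring A" "cring B"
    and "\<And>c a. a \<in> carrier A \<Longrightarrow> c \<odot>\<^bsub>A\<^esub> a \<in> carrier A"
    and "\<And>c b. b \<in> carrier B \<Longrightarrow> c \<odot>\<^bsub>B\<^esub> b \<in> carrier B"
  shows "bilinearity_relations A B \<subseteq> carrier (monoid_algebra (A \<times>\<times> B))"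
proof -
  interpret A: cring A by fact
  interpret B: cring B by fact
  have diff: "Poly_Mapping.keys (p - q) \<subseteq> S"
    if "Poly_Mapping.keys p \<subseteq> S" "Poly_Mapping.keys q \<subseteq> S" for p q :: "'a \<times> 'b \<Rightarrow>\<^sub>0 'k" and S
    using order_trans[OF keys_diff Un_least[OF that]] .
  have single: "Poly_Mapping.keys (Poly_Mapping.single x c) \<subseteq> S" if "x \<in> S"
    for x :: "'a \<times> 'b" and c :: 'k and S
    using that by simp
  have "Poly_Mapping.keys r \<subseteq> carrier A \<times> carrier B" if "r \<in> bilinearity_relations A B" for r
    using that unfolding bilinearity_relations_def Un_iff mem_Collect_eq
    by (elim disjE exE conjE; simp only:; intro diff single; simp add: assms)
  then show ?thesis by auto
qed

text \<open>
  Two algebra homomorphisms into a commutative algebra have a product on the tensor product: the map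
  \<open>(a, b) \<mapsto> \<alpha> a * \<beta> b\<close> extends to a ring homomorphism on the free vector space, and its
  kernel is an ideal that contains the bilinearity relations.
\<close>

lemma tensor_lift:
  fixes A :: "('k::field, 'a) module" and B :: "('k, 'b) module" and N :: "'c monoid"
  assumes A: "cring A" "\<And>c a. a \<in> carrier A \<Longrightarrow> c \<odot>\<^bsub>A\<^esub> a \<in> carrier A"
    and B: "cring B" "\<And>c b. b \<in> carrier B \<Longrightarrow> c \<odot>\<^bsub>B\<^esub> b \<in> carrier B"
    and N: "comm_monoid N"
    and \<alpha>: "\<alpha> \<in> ring_hom A (monoid_algebra N)" "\<And>c a. a \<in> carrier A \<Longrightarrow> \<alpha> (c \<odot>\<^bsub>A\<^esub> a) = scale c (\<alpha> a)"
    and \<beta>: "\<beta> \<in> ring_hom B (monoid_algebra N)" "\<And>c b. b \<in> carrier B \<Longrightarrow> \<beta> (c \<odot>\<^bsub>B\<^esub> b) = scale c (\<beta> b)"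
    and z: "z \<in> Idl\<^bsub>monoid_algebra (A \<times>\<times> B)\<^esub> (bilinearity_relations A B)"
  shows "lin_ext (\<lambda>(a, b). \<alpha> a \<otimes>\<^bsub>monoid_algebra N\<^esub> \<beta> b) z = (0 :: 'c \<Rightarrow>\<^sub>0 'k)"
proof -
  let ?N = "monoid_algebra N :: ('k, 'c \<Rightarrow>\<^sub>0 'k) module"
  let ?AB = "monoid_algebra (A \<times>\<times> B) :: ('k, 'a \<times> 'b \<Rightarrow>\<^sub>0 'k) module"
  let ?f = "\<lambda>(a, b). \<alpha> a \<otimes>\<^bsub>?N\<^esub> \<beta> b"
  interpret A: cring A by fact
  interpret B: cring B by fact
  interpret N: cring ?N using N by (rule comm_monoid.cring_monoid_algebra)
  have AB: "comm_monoid (A \<times>\<times> B)"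
    by (rule comm_monoid_DirProd) (rule A.comm_monoid_axioms B.comm_monoid_axioms)+
  interpret AB: cring ?AB using AB by (rule comm_monoid.cring_monoid_algebra)
  have closed: "a \<in> carrier A \<Longrightarrow> \<alpha> a \<in> carrier ?N" "b \<in> carrier B \<Longrightarrow> \<beta> b \<in> carrier ?N" for a b
    using ring_hom_closed[OF \<alpha>(1)] ring_hom_closed[OF \<beta>(1)] by blast+
  have hom: "?f \<in> hom (A \<times>\<times> B) ?N"
  proof (rule homI)
    fix x y assume "x \<in> carrier (A \<times>\<times> B)" "y \<in> carrier (A \<times>\<times> B)"
    then show "?f (x \<otimes>\<^bsub>A \<times>\<times> B\<^esub> y) = ?f x \<otimes>\<^bsub>?N\<^esub> ?f y"
      using closed
      by (cases x; cases y)
        (simp add: ring_hom_mult[OF \<alpha>(1)] ring_hom_mult[OF \<beta>(1)] N.m_ac del: monoid_algebra_simps)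
  qed (use closed in \<open>auto simp del: monoid_algebra_simps\<close>)
  have one: "?f \<one>\<^bsub>A \<times>\<times> B\<^esub> = \<one>\<^bsub>?N\<^esub>"
    by (simp add: ring_hom_one[OF \<alpha>(1)] ring_hom_one[OF \<beta>(1)] del: monoid_algebra_simps)
  have ring_hom: "lin_ext ?f \<in> ring_hom ?AB ?N"
    using lin_ext_ring_hom[OF AB N hom one] .
  interpret ring_hom_ring ?AB ?N "lin_ext ?f"
    by (rule ring_hom_ringI2[OF AB.ring_axioms N.ring_axioms ring_hom])
  have "ideal {z \<in> carrier ?AB. lin_ext ?f z \<in> {\<zero>\<^bsub>?N\<^esub>}} ?AB"
    by (rule ideal_vimage[OF N.zeroideal])
  moreover have "lin_ext ?f r = 0" if "r \<in> bilinearity_relations A B" for r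
    using that ring_hom_add[OF \<alpha>(1)] ring_hom_add[OF \<beta>(1)]
    by (auto simp: bilinearity_relations_def lin_ext_diff \<alpha>(2) \<beta>(2) monoid_algebra_mult_bilinear)
  then have "bilinearity_relations A B \<subseteq> {z \<in> carrier ?AB. lin_ext ?f z \<in> {\<zero>\<^bsub>?N\<^esub>}}"
    using bilinearity_relations_closed[OF A(1) B(1) A(2) B(2)] by auto
  ultimately have "z \<in> {z \<in> carrier ?AB. lin_ext ?f z \<in> {\<zero>\<^bsub>?N\<^esub>}}"
    using AB.genideal_minimal z by blast
  then show ?thesis by simp
qed

text \<open>
  Spanning by tensors of monomials, stated as closure: a subspace \<open>D\<close> of the free vector space that
  contains the bilinearity relations and all pairs of (classes of) monomials is everything. The first
  component is expanded into monomials, then the second.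
\<close>

lemma tensor_span:
  fixes M :: "'a monoid" and N :: "'b monoid" and P :: "('a \<Rightarrow>\<^sub>0 'k::field) set"
  defines "A \<equiv> quotient_algebra (monoid_algebra M) P" and "B \<equiv> monoid_algebra N"
  assumes M: "comm_monoid M" and N: "comm_monoid N" and P: "ideal P (monoid_algebra M)"
    and add: "\<And>x y. x \<in> D \<Longrightarrow> y \<in> D \<Longrightarrow> x + y \<in> D"
    and scale: "\<And>c x. x \<in> D \<Longrightarrow> scale c x \<in> D"
    and relations: "bilinearity_relations A B \<subseteq> D"
    and generators: "\<And>u v. u \<in> carrier M \<Longrightarrow> v \<in> carrier N \<Longrightarrow>
      Poly_Mapping.single (P +>\<^bsub>monoid_algebra M\<^esub> Poly_Mapping.single u 1, Poly_Mapping.single v 1) 1 \<in> D"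
    and z: "Poly_Mapping.keys z \<subseteq> carrier (A \<times>\<times> B)"
  shows "z \<in> D"
proof -
  let ?M = "monoid_algebra M :: ('k, 'a \<Rightarrow>\<^sub>0 'k) module"
  let ?c = "\<lambda>p. P +>\<^bsub>?M\<^esub> p"
  interpret M: comm_monoid M by fact
  interpret N: comm_monoid N by fact
  interpret KM: cring ?M by (rule M.cring_monoid_algebra)
  have carA: "?c p \<in> carrier A" if "Poly_Mapping.keys p \<subseteq> carrier M" for p
    unfolding A_def carrier_quotient_algebra using that by simp
  have addA: "?c p \<oplus>\<^bsub>A\<^esub> ?c q = ?c (p + q)"
    if "Poly_Mapping.keys p \<subseteq> carrier M" "Poly_Mapping.keys q \<subseteq> carrier M" for p q
    using ring_hom_add[OF quotient_map_ring_hom[OF P], of p q] that by (simp add: A_def)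
  have smultA: "c \<odot>\<^bsub>A\<^esub> ?c p = ?c (scale c p)" if "Poly_Mapping.keys p \<subseteq> carrier M" for p c
    unfolding A_def by (rule M.quotient_monoid_algebra_smult[OF P that])
  have shift: "x \<in> D" if "x - y \<in> D" "y \<in> D" for x y
    using add[OF that] by simp
  have rel1: "Poly_Mapping.single (a \<oplus>\<^bsub>A\<^esub> a', b) 1 \<in> D"
    if "Poly_Mapping.single (a, b) 1 \<in> D" "Poly_Mapping.single (a', b) 1 \<in> D"
      "a \<in> carrier A" "a' \<in> carrier A" "b \<in> carrier B" for a a' b
  proof (rule shift)
    show "Poly_Mapping.single (a \<oplus>\<^bsub>A\<^esub> a', b) 1 - (Poly_Mapping.single (a, b) 1 + Poly_Mapping.single (a', b) 1) \<in> D"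
      using subsetD[OF relations bilinearity_relationsI(1)[OF that(3-5)]] by (simp only: diff_diff_eq)
  qed (rule add[OF that(1,2)])
  have rel2: "Poly_Mapping.single (a, b \<oplus>\<^bsub>B\<^esub> b') 1 \<in> D"
    if "Poly_Mapping.single (a, b) 1 \<in> D" "Poly_Mapping.single (a, b') 1 \<in> D"
      "a \<in> carrier A" "b \<in> carrier B" "b' \<in> carrier B" for a b b'
  proof (rule shift)
    show "Poly_Mapping.single (a, b \<oplus>\<^bsub>B\<^esub> b') 1 - (Poly_Mapping.single (a, b) 1 + Poly_Mapping.single (a, b') 1) \<in> D"
      using subsetD[OF relations bilinearity_relationsI(2)[OF that(3-5)]] by (simp only: diff_diff_eq)
  qed (rule add[OF that(1,2)])
  have rel3: "Poly_Mapping.single (c \<odot>\<^bsub>A\<^esub> a, b) 1 \<in> D"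
    if "Poly_Mapping.single (a, b) 1 \<in> D" "a \<in> carrier A" "b \<in> carrier B" for a b c
  proof (rule shift)
    show "Poly_Mapping.single (c \<odot>\<^bsub>A\<^esub> a, b) 1 - Poly_Mapping.single (a, b) c \<in> D"
      by (rule subsetD[OF relations bilinearity_relationsI(3)[OF that(2,3)]])
    show "Poly_Mapping.single (a, b) c \<in> D" using scale[OF that(1), of c] by simp
  qed
  have rel4: "Poly_Mapping.single (a, c \<odot>\<^bsub>B\<^esub> b) 1 \<in> D"
    if "Poly_Mapping.single (a, b) 1 \<in> D" "a \<in> carrier A" "b \<in> carrier B" for a b c
  proof (rule shift)
    show "Poly_Mapping.single (a, c \<odot>\<^bsub>B\<^esub> b) 1 - Poly_Mapping.single (a, b) c \<in> D"
      by (rule subsetD[OF relations bilinearity_relationsI(4)[OF that(2,3)]])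
    show "Poly_Mapping.single (a, b) c \<in> D" using scale[OF that(1), of c] by simp
  qed
  have left: "Poly_Mapping.single (?c p, Poly_Mapping.single v 1) 1 \<in> D"
    if p: "Poly_Mapping.keys p \<subseteq> carrier M" and v: "v \<in> carrier N" for p v
  proof -
    have vB: "Poly_Mapping.single v 1 \<in> carrier B" using v by (simp add: B_def)
    have mono: "Poly_Mapping.single (?c (Poly_Mapping.single u c), Poly_Mapping.single v 1) 1 \<in> D"
      if "u \<in> carrier M" for u c
      using rel3[OF generators[OF that v] _ vB, of c] carA[of "Poly_Mapping.single u 1"] that
      by (simp add: smultA)
    show ?thesis
      using p
    proof (rule span_induct)
      show "Poly_Mapping.single (?c 0, Poly_Mapping.single v 1) 1 \<in> D"
        using mono[OF M.one_closed, of 0] by simp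
      show "Poly_Mapping.single (?c (Poly_Mapping.single u c + q), Poly_Mapping.single v 1) 1 \<in> D"
        if "u \<in> carrier M" "Poly_Mapping.keys q \<subseteq> carrier M"
          "Poly_Mapping.single (?c q, Poly_Mapping.single v 1) 1 \<in> D" for u c q
        using rel1[OF mono[OF that(1), of c] that(3) carA carA vB] that(1,2) by (simp add: addA)
    qed
  qed
  have pure: "Poly_Mapping.single (a, q) 1 \<in> D" if a: "a \<in> carrier A" and q: "q \<in> carrier B" for a q
  proof -
    obtain p where p: "a = ?c p" "Poly_Mapping.keys p \<subseteq> carrier M"
      using a unfolding A_def carrier_quotient_algebra by auto
    have mono: "Poly_Mapping.single (a, Poly_Mapping.single v c) 1 \<in> D" if "v \<in> carrier N" for v c
      using rel4[OF left[OF p(2) that], of c] a that by (simp add: p(1) B_def)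
    have "Poly_Mapping.keys q \<subseteq> carrier N" using q by (simp add: B_def)
    then show ?thesis
    proof (rule span_induct)
      show "Poly_Mapping.single (a, 0) 1 \<in> D"
        using mono[OF N.one_closed, of 0] by simp
      show "Poly_Mapping.single (a, Poly_Mapping.single v c + q) 1 \<in> D"
        if "v \<in> carrier N" "Poly_Mapping.keys q \<subseteq> carrier N" "Poly_Mapping.single (a, q) 1 \<in> D" for v c q
        using rel2[OF mono[OF that(1), of c] that(3) a] that(1,2) by (simp add: B_def)
    qed
  qed
  have zero: "0 \<in> D" using scale[OF generators[OF M.one_closed N.one_closed], of 0] by simp
  show ?thesis
    using z
  proof (rule span_induct[where P = "\<lambda>z. z \<in> D"])
    show "Poly_Mapping.single x c + y \<in> D" if "x \<in> carrier (A \<times>\<times> B)" "y \<in> D" for x c y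
      using add[OF scale[OF pure, of "fst x" "snd x" c] that(2)] that(1) by (cases x) simp
  qed (rule zero)
qed

section \<open>The product ideal\<close>

lemma product_relations_eq:
  "product_relations n m =
    {Poly_Mapping.single {#T1, T2#} 1 - Poly_Mapping.single {#T3, T4#} 1 | T1 T2 T3 T4.
      product_relation n m T1 T2 T3 T4}"
  by (simp add: product_relations_def product_relation_def)

abbreviation E_part :: "nat \<Rightarrow> nat \<Rightarrow> tableau multiset \<Rightarrow> tableau multiset"
  where "E_part n m \<equiv> filter_mset (\<lambda>T. T \<notin> F n m)"

abbreviation F_part :: "nat \<Rightarrow> nat \<Rightarrow> tableau multiset \<Rightarrow> tableau multiset"
  where "F_part n m \<equiv> filter_mset (\<lambda>T. T \<in> F n m)"

text \<open>
  Any decomposition into columns serves, since two of them are equal modulo product relations.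
\<close>

definition columns_of :: "nat \<Rightarrow> nat \<Rightarrow> tableau \<Rightarrow> tableau multiset"
  where "columns_of n m T = (SOME u. set_mset u \<subseteq> G n m \<and> total_content u = content T)"

lemma columns_of:
  assumes "T \<in> SSYT n m"
  shows "set_mset (columns_of n m T) \<subseteq> G n m" "total_content (columns_of n m T) = content T"
proof -
  have "\<exists>u. set_mset u \<subseteq> G n m \<and> total_content u = content T"
    using column_decomposition[OF assms] by metis
  from someI_ex[OF this] show "set_mset (columns_of n m T) \<subseteq> G n m" "total_content (columns_of n m T) = content T"
    by (simp_all add: columns_of_def)
qed

context
  fixes n m :: nat
  assumes n_pos: "0 < n" and n_le_m: "n \<le> m"
begin

lemma product_relations_carrier:
  "(product_relations n m :: 'k::field tableau_poly set) \<subseteq> carrier (polynomial_algebra (E n m))"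
proof
  fix r :: "'k tableau_poly" assume "r \<in> product_relations n m"
  then obtain T1 T2 T3 T4 where r: "r = Poly_Mapping.single {#T1, T2#} 1 - Poly_Mapping.single {#T3, T4#} 1"
    and rel: "product_relation n m T1 T2 T3 T4"
    unfolding product_relations_eq by blast
  have "Poly_Mapping.keys r \<subseteq> {{#T1, T2#}, {#T3, T4#}}"
    unfolding r by (rule order_trans[OF keys_diff]) auto
  then show "r \<in> carrier (polynomial_algebra (E n m))"
    using product_relation_in_E[OF n_pos n_le_m rel] by (auto simp: polynomial_algebra_def)
qed

lemma product_ideal_ideal:
  "ideal (product_ideal n m) (polynomial_algebra (E n m) :: ('k::field, _) module)"
proof -
  interpret cring "polynomial_algebra (E n m) :: ('k, _) module" by (rule cring_polynomial_algebra)
  show ?thesis unfolding product_ideal_def by (rule genideal_ideal[OF product_relations_carrier])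
qed

lemma product_relations_in_ideal:
  "product_relations n m \<subseteq> (product_ideal n m :: 'k::field tableau_poly set)"
proof -
  interpret cring "polynomial_algebra (E n m) :: ('k, _) module" by (rule cring_polynomial_algebra)
  show ?thesis unfolding product_ideal_def by (rule genideal_self[OF product_relations_carrier])
qed

lemmas product_ideal_closed =
  comm_monoid.ideal_zero[OF comm_monoid_monomial_monoid product_ideal_ideal[unfolded polynomial_algebra_def]]
  comm_monoid.ideal_add[OF comm_monoid_monomial_monoid product_ideal_ideal[unfolded polynomial_algebra_def]]
  comm_monoid.ideal_scale[OF comm_monoid_monomial_monoid product_ideal_ideal[unfolded polynomial_algebra_def]]

text \<open>
  An exchange takes place among variables in \<open>E\<close>, so the \<open>F\<close>-part stays fixed and the \<open>E\<close>-part changes by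
  a monomial multiple of a product relation.
\<close>

lemma product_equivalent_parts:
  assumes "product_equivalent n m u v"
  shows "F_part n m u = F_part n m v"
    "Poly_Mapping.single (E_part n m u) 1 - Poly_Mapping.single (E_part n m v) 1
      \<in> (product_ideal n m :: 'k::field tableau_poly set)"
proof -
  let ?P = "product_ideal n m :: 'k tableau_poly set"
  let ?s = "\<lambda>u. Poly_Mapping.single u 1 :: 'k tableau_poly"
  have "F_part n m u = F_part n m v \<and> ?s (E_part n m u) - ?s (E_part n m v) \<in> ?P"
    using assms
  proof (induction rule: product_equivalent.induct)
    case (refl u)
    show ?case using product_ideal_closed(1) by simp
  next
    case (sym u v)
    then show ?case using product_ideal_closed(3)[of "?s (E_part n m u) - ?s (E_part n m v)" "- 1"]
      by (simp add: scale_distrib single_uminus flip: single_diff)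
  next
    case (trans u v w)
    then show ?case
      using product_ideal_closed(2)[of "?s (E_part n m u) - ?s (E_part n m v)" "?s (E_part n m v) - ?s (E_part n m w)"]
      by simp
  next
    case (exchange T1 T2 T3 T4 u)
    interpret ideal ?P "polynomial_algebra (E n m)" by (rule product_ideal_ideal)
    have E: "{T1, T2, T3, T4} \<subseteq> E n m" by (rule product_relation_in_E[OF n_pos n_le_m exchange(1)])
    then have parts: "E_part n m ({#T1, T2#} + u) = {#T1, T2#} + E_part n m u"
      "E_part n m ({#T3, T4#} + u) = {#T3, T4#} + E_part n m u"
      "F_part n m ({#T1, T2#} + u) = F_part n m u" "F_part n m ({#T3, T4#} + u) = F_part n m u"
      by (auto simp: E_def)
    have "?s {#T1, T2#} - ?s {#T3, T4#} \<in> ?P"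
      using product_relations_in_ideal exchange(1) unfolding product_relations_eq by blast
    then have "(?s {#T1, T2#} - ?s {#T3, T4#}) \<otimes>\<^bsub>polynomial_algebra (E n m)\<^esub> ?s (E_part n m u) \<in> ?P"
      using exchange(2) by (intro I_r_closed) (auto simp: polynomial_algebra_def E_def)
    moreover have "(p - q) \<otimes>\<^bsub>polynomial_algebra (E n m)\<^esub> r =
        p \<otimes>\<^bsub>polynomial_algebra (E n m)\<^esub> r - q \<otimes>\<^bsub>polynomial_algebra (E n m)\<^esub> r" for p q r :: "'k tableau_poly"
      using monoid_algebra_mult_bilinear(1)[where p = "p - q" and p' = q and q = r and M = "monomial_monoid (E n m)"]
      by (simp add: polynomial_algebra_def algebra_simps)
    ultimately show ?case
      unfolding parts by (simp add: polynomial_algebra_def)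
  qed
  then show "F_part n m u = F_part n m v" "?s (E_part n m u) - ?s (E_part n m v) \<in> ?P" by auto
qed

text \<open>
  One inclusion holds as product relations have value zero. For the other, fix for every exponent
  that occurs a monomial with that value. Replacing each monomial of \<open>p\<close> by the chosen one changes \<open>p\<close> by an element
  of the ideal, and the outcome depends only on the value of \<open>p\<close>. If this value is zero, the outcome is
  zero and \<open>p\<close> lies in the ideal.
\<close>

lemma product_ideal_eq_kernel:
  "product_ideal n m = {p \<in> carrier (polynomial_algebra (E n m)). poly_value p = (0 :: _ \<Rightarrow>\<^sub>0 'k::field)}"
proof (intro subset_antisym subsetI)
  let ?K = "polynomial_algebra (E n m) :: ('k, _) module"
  interpret cring ?K by (rule cring_polynomial_algebra)
  have "ideal {p \<in> carrier ?K. poly_value p = \<zero>\<^bsub>monoid_algebra exponent_monoid\<^esub>} ?K"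
    using prime_kernel[OF cring_polynomial_algebra domain_exponent_algebra poly_value_ring_hom]
    by (rule primeideal.axioms(1))
  moreover have "product_relations n m \<subseteq> {p \<in> carrier ?K. poly_value p = \<zero>\<^bsub>monoid_algebra exponent_monoid\<^esub>}"
  proof (rule subsetI, rule CollectI, rule conjI)
    fix r :: "'k tableau_poly" assume r: "r \<in> product_relations n m"
    show "r \<in> carrier ?K" using product_relations_carrier r by blast
    obtain T1 T2 T3 T4 where r: "r = Poly_Mapping.single {#T1, T2#} 1 - Poly_Mapping.single {#T3, T4#} 1"
      and rel: "product_relation n m T1 T2 T3 T4"
      using r unfolding product_relations_eq by blast
    have "content (T1 \<star> T2) = content (T3 \<star> T4)" using rel by (simp add: product_relation_def)
    then show "poly_value r = \<zero>\<^bsub>monoid_algebra exponent_monoid\<^esub>"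
      by (simp add: r poly_value_def content_star)
  qed
  ultimately have "product_ideal n m \<subseteq> {p \<in> carrier ?K. poly_value p = \<zero>\<^bsub>monoid_algebra exponent_monoid\<^esub>}"
    unfolding product_ideal_def by (rule genideal_minimal)
  then show "p \<in> {p \<in> carrier ?K. poly_value p = 0}" if "p \<in> product_ideal n m" for p using that by auto
next
  let ?K = "polynomial_algebra (E n m) :: ('k, _) module"
  let ?P = "product_ideal n m :: 'k tableau_poly set"
  fix p assume p: "p \<in> {p \<in> carrier ?K. poly_value p = 0}"
  define rep where "rep e = (SOME u. set_mset u \<subseteq> E n m \<and> exponent (total_content u) = e)" for e
  have rep: "set_mset (rep (exponent (total_content u))) \<subseteq> E n m"
    "total_content (rep (exponent (total_content u))) = total_content u" if "set_mset u \<subseteq> E n m" for u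
  proof -
    have "\<exists>v. set_mset v \<subseteq> E n m \<and> exponent (total_content v) = exponent (total_content u)"
      using that by blast
    from someI_ex[OF this] show "set_mset (rep (exponent (total_content u))) \<subseteq> E n m"
      "total_content (rep (exponent (total_content u))) = total_content u"
      using injD[OF inj_exponent] by (auto simp: rep_def)
  qed
  let ?r = "\<lambda>u. rep (exponent (total_content u))"
  have E_part: "E_part n m u = u" if "set_mset u \<subseteq> E n m" for u
    using that by (subst filter_mset_eq_conv) (auto simp: E_def)
  have single: "Poly_Mapping.single u 1 - Poly_Mapping.single (?r u) 1 \<in> ?P" if u: "set_mset u \<subseteq> E n m" for u
  proof -
    have "set_mset u \<subseteq> G n m" "set_mset (?r u) \<subseteq> G n m" using u rep[OF u] by (auto simp: E_def)
    then have "product_equivalent n m u (?r u)"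
      using rep(2)[OF u] by (intro product_equivalent_if_content_eq) simp_all
    from product_equivalent_parts(2)[OF this] show ?thesis
      using E_part[OF u] E_part[OF rep(1)[OF u]] by simp
  qed
  have "Poly_Mapping.keys p \<subseteq> {u. set_mset u \<subseteq> E n m}" using p by (simp add: polynomial_algebra_def)
  then have "p - basis_map ?r p \<in> ?P"
  proof (rule span_induct)
    show "0 - basis_map ?r 0 \<in> ?P" using product_ideal_closed(1) by simp
    show "Poly_Mapping.single u c + q - basis_map ?r (Poly_Mapping.single u c + q) \<in> ?P"
      if "u \<in> {u. set_mset u \<subseteq> E n m}" "q - basis_map ?r q \<in> ?P" for u c q
    proof -
      have "scale c (Poly_Mapping.single u 1 - Poly_Mapping.single (?r u) 1) + (q - basis_map ?r q) \<in> ?P"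
        using that by (intro product_ideal_closed(2) product_ideal_closed(3) single) simp_all
      then show ?thesis by (simp add: scale_distrib algebra_simps)
    qed
  qed
  moreover have "basis_map ?r p = basis_map rep (poly_value p)"
    by (simp add: poly_value_def basis_map_basis_map)
  ultimately show "p \<in> ?P" using p by simp
qed

lemma product_ideal_prime:
  "primeideal (product_ideal n m) (polynomial_algebra (E n m) :: ('k::field, _) module)"
  using prime_kernel[OF cring_polynomial_algebra domain_exponent_algebra poly_value_ring_hom, of "E n m"]
  by (simp add: product_ideal_eq_kernel)

lemma tableau_map_product_ideal:
  "tableau_map n m ` product_ideal n m = {0 :: tableau \<Rightarrow>\<^sub>0 'k::field}"
proof -
  have "tableau_map n m p = 0" if "p \<in> product_ideal n m" for p :: "'k tableau_poly"
  proof -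
    have p: "Poly_Mapping.keys p \<subseteq> {u. set_mset u \<subseteq> G n m}" "poly_value p = 0"
      using that by (auto simp: product_ideal_eq_kernel polynomial_algebra_def E_def)
    have "tableau_value (tableau_map n m p) = tableau_value 0"
      using tableau_value_tableau_map(1)[OF p(1)] p(2) by (simp add: tableau_value_def)
    then show ?thesis
      by (rule inj_onD[OF tableau_value_inj[of n m]]) (use tableau_value_tableau_map(2)[OF p(1)] in auto)
  qed
  moreover have "0 \<in> (product_ideal n m :: 'k tableau_poly set)"
    by (simp add: product_ideal_eq_kernel polynomial_algebra_def poly_value_def)
  ultimately show ?thesis by force
qed

text \<open>
  The ideal is the zero ideal of a domain.
\<close>

lemma image_ideal_prime:
  "primeideal (Idl\<^bsub>tableaux_algebra n m\<^esub> (tableau_map n m ` (product_ideal n m :: 'k::field tableau_poly set)))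
    (tableaux_algebra n m)"
proof -
  interpret cring "tableaux_algebra n m :: ('k, _) module"
    unfolding tableaux_algebra_def by (rule comm_monoid.cring_monoid_algebra[OF comm_monoid_tableau_monoid])
  have "tableau_map n m ` product_ideal n m = {\<zero>\<^bsub>tableaux_algebra n m :: ('k, _) module\<^esub>}"
    by (simp add: tableau_map_product_ideal tableaux_algebra_def)
  then show ?thesis
    using tableaux_algebra_zero_prime[of n m, where 'k = 'k] by (simp add: genideal_zero)
qed

end

section \<open>The tableaux algebra as a tensor product\<close>

abbreviation E_algebra :: "nat \<Rightarrow> nat \<Rightarrow> ('k::field, 'k tableau_poly) module"
  where "E_algebra n m \<equiv> monoid_algebra (monomial_monoid (E n m))"

abbreviation residue_algebra :: "nat \<Rightarrow> nat \<Rightarrow> ('k::field, 'k tableau_poly set) module"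
  where "residue_algebra n m \<equiv> quotient_algebra (E_algebra n m) (product_ideal n m)"

abbreviation F_algebra :: "nat \<Rightarrow> nat \<Rightarrow> ('k::field, 'k tableau_poly) module"
  where "F_algebra n m \<equiv> monoid_algebra (monomial_monoid (F n m))"

abbreviation pair_algebra ::
    "nat \<Rightarrow> nat \<Rightarrow> ('k::field, 'k tableau_poly set \<times> 'k tableau_poly \<Rightarrow>\<^sub>0 'k) module"
  where "pair_algebra n m \<equiv> monoid_algebra (residue_algebra n m \<times>\<times> F_algebra n m)"

definition bilinearity_ideal :: "nat \<Rightarrow> nat \<Rightarrow> ('k::field tableau_poly set \<times> 'k tableau_poly \<Rightarrow>\<^sub>0 'k) set"
  where "bilinearity_ideal n m =
    Idl\<^bsub>pair_algebra n m\<^esub> (bilinearity_relations (residue_algebra n m) (F_algebra n m))"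

definition tableau_parts :: "nat \<Rightarrow> nat \<Rightarrow> tableau \<Rightarrow> 'k::field tableau_poly set \<times> 'k tableau_poly"
  where "tableau_parts n m T =
    (product_ideal n m +>\<^bsub>E_algebra n m\<^esub> Poly_Mapping.single (E_part n m (columns_of n m T)) 1,
     Poly_Mapping.single (F_part n m (columns_of n m T)) 1)"

text \<open>
  The value does not depend on the chosen representative, because \<open>poly_value\<close> vanishes on the product
  ideal.
\<close>

definition residue_value :: "'k::field tableau_poly set \<Rightarrow> ((nat \<Rightarrow>\<^sub>0 nat) \<Rightarrow>\<^sub>0 'k)"
  where "residue_value X = poly_value (SOME p. p \<in> X)"

context
  fixes n m :: nat
  assumes n_pos: "0 < n" and n_le_m: "n \<le> m"
begin

lemma ideal_E_algebra: "ideal (product_ideal n m) (E_algebra n m :: ('k::field, _) module)"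
  using product_ideal_ideal[OF n_pos n_le_m] by (simp add: polynomial_algebra_def)

lemma cring_E_algebra: "cring (E_algebra n m :: ('k::field, _) module)"
  and cring_F_algebra: "cring (F_algebra n m :: ('k::field, _) module)"
  using cring_polynomial_algebra by (auto simp: polynomial_algebra_def)

lemma cring_residue_algebra: "cring (residue_algebra n m :: ('k::field, _) module)"
  by (rule cring_quotient_algebra[OF ideal_E_algebra cring_E_algebra])

lemma comm_monoid_pairs:
  "comm_monoid ((residue_algebra n m :: ('k::field, _) module) \<times>\<times> (F_algebra n m :: ('k, _) module))"
  by (intro comm_monoid_DirProd cring.axioms(2) cring_residue_algebra cring_F_algebra)

lemma cring_pair_algebra: "cring (pair_algebra n m :: ('k::field, _) module)"
  by (rule comm_monoid.cring_monoid_algebra[OF comm_monoid_pairs])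

lemma residue_smult:
  assumes "set_mset ` Poly_Mapping.keys p \<subseteq> Pow (E n m)"
  shows "c \<odot>\<^bsub>residue_algebra n m\<^esub> (product_ideal n m +>\<^bsub>E_algebra n m\<^esub> p) =
    product_ideal n m +>\<^bsub>E_algebra n m\<^esub> scale (c :: 'k::field) p"
  by (rule comm_monoid.quotient_monoid_algebra_smult[OF comm_monoid_monomial_monoid ideal_E_algebra])
     (use assms in auto)

lemma residue_smult_closed:
  assumes "a \<in> carrier (residue_algebra n m :: ('k::field, _) module)"
  shows "c \<odot>\<^bsub>residue_algebra n m\<^esub> a \<in> carrier (residue_algebra n m)"
proof -
  obtain p where p: "a = product_ideal n m +>\<^bsub>E_algebra n m\<^esub> p" "p \<in> carrier (E_algebra n m)"
    using assms unfolding carrier_quotient_algebra by auto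
  have "scale c p \<in> carrier (E_algebra n m)" using p(2) keys_scale by fastforce
  moreover have "c \<odot>\<^bsub>residue_algebra n m\<^esub> a = product_ideal n m +>\<^bsub>E_algebra n m\<^esub> scale c p"
    unfolding p(1) by (rule residue_smult) (use p(2) in auto)
  ultimately show ?thesis unfolding carrier_quotient_algebra by blast
qed

lemma F_smult_closed:
  assumes "b \<in> carrier (F_algebra n m :: ('k::field, _) module)"
  shows "c \<odot>\<^bsub>F_algebra n m\<^esub> b \<in> carrier (F_algebra n m)"
  using assms keys_scale by fastforce

lemma residue_value_coset:
  assumes "p \<in> carrier (E_algebra n m :: ('k::field, _) module)"
  shows "residue_value (product_ideal n m +>\<^bsub>E_algebra n m\<^esub> p) = poly_value p"
proof -
  let ?P = "product_ideal n m :: 'k tableau_poly set"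
  let ?C = "?P +>\<^bsub>E_algebra n m\<^esub> p"
  interpret ideal ?P "E_algebra n m" by (rule ideal_E_algebra)
  have "p \<in> ?C" using a_rcos_self assms by simp
  then have "(SOME q. q \<in> ?C) \<in> ?C" by (rule someI)
  then obtain q where q: "(SOME q. q \<in> ?C) = q + p" "q \<in> ?P"
    unfolding a_r_coset_def' by auto
  then have "poly_value q = 0" by (simp add: product_ideal_eq_kernel[OF n_pos n_le_m])
  then show ?thesis by (simp add: residue_value_def q(1) poly_value_def)
qed

lemma residue_value_ring_hom:
  "residue_value \<in> ring_hom (residue_algebra n m) (monoid_algebra exponent_monoid :: ('k::field, _) module)"
proof -
  let ?E = "E_algebra n m :: ('k, _) module"
  let ?A = "residue_algebra n m :: ('k, _) module"
  let ?R = "monoid_algebra exponent_monoid :: ('k, _) module"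
  let ?c = "\<lambda>p. product_ideal n m +>\<^bsub>?E\<^esub> p"
  interpret cring ?E by (rule cring_E_algebra)
  have c: "?c \<in> ring_hom ?E ?A" by (rule quotient_map_ring_hom[OF ideal_E_algebra])
  have v: "poly_value \<in> ring_hom ?E ?R" using poly_value_ring_hom by (simp add: polynomial_algebra_def)
  have coset: "\<exists>p\<in>carrier ?E. a = ?c p" if "a \<in> carrier ?A" for a
    using that unfolding carrier_quotient_algebra by auto
  show ?thesis
  proof (rule ring_hom_memI)
    fix a assume "a \<in> carrier ?A"
    show "residue_value a \<in> carrier ?R" by simp
  next
    fix a b assume "a \<in> carrier ?A" "b \<in> carrier ?A"
    then obtain p q where pq: "a = ?c p" "b = ?c q" "p \<in> carrier ?E" "q \<in> carrier ?E"
      using coset by blast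
    have "a \<otimes>\<^bsub>?A\<^esub> b = ?c (p \<otimes>\<^bsub>?E\<^esub> q)" "a \<oplus>\<^bsub>?A\<^esub> b = ?c (p \<oplus>\<^bsub>?E\<^esub> q)"
      using ring_hom_mult[OF c] ring_hom_add[OF c] pq by metis+
    moreover have "p \<otimes>\<^bsub>?E\<^esub> q \<in> carrier ?E" "p \<oplus>\<^bsub>?E\<^esub> q \<in> carrier ?E"
      using pq(3,4) by (rule m_closed, rule add.m_closed)
    ultimately show "residue_value (a \<otimes>\<^bsub>?A\<^esub> b) = residue_value a \<otimes>\<^bsub>?R\<^esub> residue_value b"
      "residue_value (a \<oplus>\<^bsub>?A\<^esub> b) = residue_value a \<oplus>\<^bsub>?R\<^esub> residue_value b"
      using pq ring_hom_mult[OF v pq(3,4)] ring_hom_add[OF v pq(3,4)] residue_value_coset by metis+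
  next
    show "residue_value \<one>\<^bsub>?A\<^esub> = \<one>\<^bsub>?R\<^esub>"
      using ring_hom_one[OF c] ring_hom_one[OF v] residue_value_coset[OF one_closed] by metis
  qed
qed

lemma tableau_parts_eq:
  assumes "T \<in> SSYT n m" "set_mset u \<subseteq> G n m" "total_content u = content T"
  shows "tableau_parts n m T =
    (product_ideal n m +>\<^bsub>E_algebra n m\<^esub> Poly_Mapping.single (E_part n m u) 1,
     Poly_Mapping.single (F_part n m u) (1 :: 'k::field))"
proof -
  have "product_equivalent n m (columns_of n m T) u"
    using columns_of[OF assms(1)] assms by (intro product_equivalent_if_content_eq) simp_all
  note parts = product_equivalent_parts(1)[OF n_pos n_le_m this]
    product_equivalent_parts(2)[OF n_pos n_le_m this, where 'k = 'k]
  have keys: "Poly_Mapping.keys (Poly_Mapping.single (E_part n m v) (1 :: 'k)) \<subseteq> carrier (monomial_monoid (E n m))"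
    if "set_mset v \<subseteq> G n m" for v
    using that by (auto simp: E_def)
  have "product_ideal n m +>\<^bsub>E_algebra n m\<^esub> Poly_Mapping.single (E_part n m (columns_of n m T)) (1 :: 'k) =
      product_ideal n m +>\<^bsub>E_algebra n m\<^esub> Poly_Mapping.single (E_part n m u) 1"
    using parts(2) comm_monoid.monoid_algebra_coset_eq_iff[OF comm_monoid_monomial_monoid ideal_E_algebra
        keys[OF columns_of(1)[OF assms(1)]] keys[OF assms(2)]] by simp
  then show ?thesis by (simp add: tableau_parts_def parts(1))
qed

lemma tableau_parts_hom:
  "tableau_parts n m \<in> hom (tableau_monoid n m)
    ((residue_algebra n m :: ('k::field, _) module) \<times>\<times> (F_algebra n m :: ('k, _) module))"
proof (rule homI)
  let ?E = "E_algebra n m :: ('k, _) module"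
  let ?A = "residue_algebra n m :: ('k, _) module"
  let ?c = "\<lambda>u. product_ideal n m +>\<^bsub>?E\<^esub> Poly_Mapping.single (E_part n m u) 1"
  let ?s = "\<lambda>u. Poly_Mapping.single u 1 :: 'k tableau_poly"
  have E: "Poly_Mapping.single (E_part n m u) (1::'k) \<in> carrier ?E" if "set_mset u \<subseteq> G n m" for u
    using that by (auto simp: E_def)
  have c: "(\<lambda>p. product_ideal n m +>\<^bsub>?E\<^esub> p) \<in> ring_hom ?E ?A"
    by (rule quotient_map_ring_hom[OF ideal_E_algebra])
  show "tableau_parts n m T \<in> carrier (?A \<times>\<times> (F_algebra n m :: ('k, _) module))"
    if "T \<in> carrier (tableau_monoid n m)" for T
    using ring_hom_closed[OF c E] columns_of(1)[of T n m] that by (auto simp: tableau_parts_def)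
  fix T U assume TU: "T \<in> carrier (tableau_monoid n m)" "U \<in> carrier (tableau_monoid n m)"
  let ?t = "columns_of n m T" and ?u = "columns_of n m U"
  have t: "set_mset ?t \<subseteq> G n m" "total_content ?t = content T"
    and u: "set_mset ?u \<subseteq> G n m" "total_content ?u = content U"
    using columns_of TU by simp_all
  have "tableau_parts n m (T \<star> U) = (?c (?t + ?u), ?s (F_part n m (?t + ?u)))"
    using t u TU by (intro tableau_parts_eq) (simp_all add: SSYT_star content_star)
  also have "?c (?t + ?u) = ?c ?t \<otimes>\<^bsub>?A\<^esub> ?c ?u"
    using ring_hom_mult[OF c E[OF t(1)] E[OF u(1)]] by simp
  finally show "tableau_parts n m (T \<otimes>\<^bsub>tableau_monoid n m\<^esub> U) =
      tableau_parts n m T \<otimes>\<^bsub>?A \<times>\<times> F_algebra n m\<^esub> tableau_parts n m U"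
    by (simp add: tableau_parts_def)
qed

lemma tableau_parts_one:
  "tableau_parts n m [] = \<one>\<^bsub>(residue_algebra n m :: ('k::field, _) module) \<times>\<times> (F_algebra n m :: ('k, _) module)\<^esub>"
  using ring_hom_one[OF quotient_map_ring_hom[OF ideal_E_algebra[where 'k = 'k]]]
  by (simp add: tableau_parts_eq[OF Nil_in_SSYT, of "{#}"])

lemma ideal_bilinearity_ideal: "ideal (bilinearity_ideal n m) (pair_algebra n m :: ('k::field, _) module)"
proof -
  interpret cring "pair_algebra n m :: ('k, _) module" by (rule cring_pair_algebra)
  show ?thesis
    unfolding bilinearity_ideal_def
    by (intro genideal_ideal bilinearity_relations_closed cring_residue_algebra cring_F_algebra
        residue_smult_closed F_smult_closed)
qed

lemma bilinearity_relations_in_ideal: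
  "bilinearity_relations (residue_algebra n m) (F_algebra n m) \<subseteq>
    (bilinearity_ideal n m :: ('k::field tableau_poly set \<times> _ \<Rightarrow>\<^sub>0 'k) set)"
proof -
  interpret cring "pair_algebra n m :: ('k, _) module" by (rule cring_pair_algebra)
  show ?thesis
    unfolding bilinearity_ideal_def
    by (intro genideal_self bilinearity_relations_closed cring_residue_algebra cring_F_algebra
        residue_smult_closed F_smult_closed)
qed

text \<open>
  The product of the values on the two tensor factors maps the image of a tableau to the monomial of its
  content. So the image of \<open>p\<close> in the tensor product determines \<open>tableau_value p\<close>, and this determines \<open>p\<close>.
\<close>

lemma tableau_parts_independent:
  assumes "Poly_Mapping.keys p \<subseteq> SSYT n m" "Poly_Mapping.keys q \<subseteq> SSYT n m"
    and "basis_map (tableau_parts n m) p - basis_map (tableau_parts n m) q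
      \<in> (bilinearity_ideal n m :: ('k::field tableau_poly set \<times> 'k tableau_poly \<Rightarrow>\<^sub>0 'k) set)"
  shows "p = q"
proof -
  let ?R = "monoid_algebra exponent_monoid :: ('k, _) module"
  let ?val = "\<lambda>(a, b). residue_value a \<otimes>\<^bsub>?R\<^esub> poly_value b"
  have smult: "residue_value (c \<odot>\<^bsub>residue_algebra n m\<^esub> a) = scale c (residue_value a)"
    if "a \<in> carrier (residue_algebra n m)" for a and c :: 'k
  proof -
    obtain r where r: "a = product_ideal n m +>\<^bsub>E_algebra n m\<^esub> r" "r \<in> carrier (E_algebra n m)"
      using \<open>a \<in> carrier (residue_algebra n m)\<close> unfolding carrier_quotient_algebra by auto
    have "scale c r \<in> carrier (E_algebra n m)" using r(2) keys_scale by fastforce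
    moreover have "c \<odot>\<^bsub>residue_algebra n m\<^esub> a = product_ideal n m +>\<^bsub>E_algebra n m\<^esub> scale c r"
      unfolding r(1) by (rule residue_smult) (use r(2) in auto)
    ultimately show ?thesis
      unfolding r(1) by (simp only: residue_value_coset r(2)) (simp add: poly_value_def)
  qed
  have F: "poly_value \<in> ring_hom (F_algebra n m) ?R"
    using poly_value_ring_hom by (simp add: polynomial_algebra_def)
  have "lin_ext ?val (basis_map (tableau_parts n m) p - basis_map (tableau_parts n m) q) = 0"
    using assms(3) unfolding bilinearity_ideal_def
    by (intro tensor_lift[OF cring_residue_algebra residue_smult_closed cring_F_algebra F_smult_closed
        comm_monoid_exponent_monoid residue_value_ring_hom smult F])
       (simp_all add: poly_value_def)
  then have "lin_ext ?val (basis_map (tableau_parts n m) p) = lin_ext ?val (basis_map (tableau_parts n m) q)"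
    by (simp add: lin_ext_diff)
  moreover have "lin_ext ?val (basis_map (tableau_parts n m) r) = tableau_value r"
    if "Poly_Mapping.keys r \<subseteq> SSYT n m" for r
    unfolding lin_ext_basis_map unfolding tableau_value_def basis_map_def
  proof (rule lin_ext_cong)
    fix T assume "T \<in> Poly_Mapping.keys r"
    then have T: "T \<in> SSYT n m" using that by auto
    let ?u = "columns_of n m T"
    have "Poly_Mapping.single (E_part n m ?u) (1::'k) \<in> carrier (E_algebra n m)"
      using columns_of(1)[OF T] by (auto simp: E_def)
    then have "?val (tableau_parts n m T) = Poly_Mapping.single
        (exponent (total_content (E_part n m ?u) + total_content (F_part n m ?u))) 1"
      by (simp add: tableau_parts_def residue_value_coset poly_value_def exponent_add)
    also have "total_content (E_part n m ?u) + total_content (F_part n m ?u) = content T"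
      using columns_of(2)[OF T] multiset_partition[of ?u "\<lambda>T. T \<in> F n m"]
      by (metis add.commute image_mset_union sum_mset.union)
    finally show "?val (tableau_parts n m T) = Poly_Mapping.single (exponent (content T)) 1" .
  qed
  ultimately have "tableau_value p = tableau_value q" using assms(1,2) by simp
  then show ?thesis using inj_onD[OF tableau_value_inj] assms(1,2) by blast
qed

text \<open>
  The elements that are congruent to a combination of images of tableaux form a subspace containing the
  bilinearity relations. A pair of monomials in \<open>E\<close> and in \<open>F\<close> is the image of the tableau that is the product
  of all their columns.
\<close>

lemma tableau_parts_spanning:
  assumes "z \<in> carrier (pair_algebra n m :: ('k::field, _) module)"
  obtains p where "Poly_Mapping.keys p \<subseteq> SSYT n m"
    "z - basis_map (tableau_parts n m) p \<in> bilinearity_ideal n m"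
proof -
  let ?I = "bilinearity_ideal n m :: ('k tableau_poly set \<times> _ \<Rightarrow>\<^sub>0 'k) set"
  let ?D = "{z. \<exists>p. Poly_Mapping.keys p \<subseteq> SSYT n m \<and> z - basis_map (tableau_parts n m) p \<in> ?I}"
  note I = comm_monoid.ideal_add[OF comm_monoid_pairs ideal_bilinearity_ideal]
    comm_monoid.ideal_scale[OF comm_monoid_pairs ideal_bilinearity_ideal]
  have zero: "0 \<in> ?I" by (rule comm_monoid.ideal_zero[OF comm_monoid_pairs ideal_bilinearity_ideal])
  have "z \<in> ?D"
  proof (rule tensor_span[OF comm_monoid_monomial_monoid comm_monoid_monomial_monoid ideal_E_algebra])
    fix x y assume "x \<in> ?D" "y \<in> ?D"
    then obtain p q where pq: "Poly_Mapping.keys p \<subseteq> SSYT n m" "x - basis_map (tableau_parts n m) p \<in> ?I"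
      "Poly_Mapping.keys q \<subseteq> SSYT n m" "y - basis_map (tableau_parts n m) q \<in> ?I" by blast
    have "x + y - basis_map (tableau_parts n m) (p + q) \<in> ?I"
      using I(1)[OF pq(2,4)] by (simp add: algebra_simps)
    moreover have "Poly_Mapping.keys (p + q) \<subseteq> SSYT n m"
      by (rule order_trans[OF keys_add]) (use pq in auto)
    ultimately show "x + y \<in> ?D" by blast
  next
    fix c x assume "x \<in> ?D"
    then obtain p where p: "Poly_Mapping.keys p \<subseteq> SSYT n m" "x - basis_map (tableau_parts n m) p \<in> ?I"
      by blast
    have "scale c x - basis_map (tableau_parts n m) (scale c p) \<in> ?I"
      using I(2)[OF p(2), of c] by (simp add: scale_distrib)
    moreover have "Poly_Mapping.keys (scale c p) \<subseteq> SSYT n m"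
      by (rule order_trans[OF keys_scale p(1)])
    ultimately show "scale c x \<in> ?D" by blast
  next
    show "bilinearity_relations (residue_algebra n m) (F_algebra n m) \<subseteq> ?D"
    proof
      fix r :: "'k tableau_poly set \<times> 'k tableau_poly \<Rightarrow>\<^sub>0 'k"
      assume "r \<in> bilinearity_relations (residue_algebra n m) (F_algebra n m)"
      then have "r \<in> ?I" using bilinearity_relations_in_ideal by blast
      then show "r \<in> ?D" by (intro CollectI exI[of _ 0]) simp
    qed
  next
    fix u v assume "u \<in> carrier (monomial_monoid (E n m))" "v \<in> carrier (monomial_monoid (F n m))"
    then have uv: "set_mset u \<subseteq> E n m" "set_mset v \<subseteq> F n m" by simp_all
    then have G: "set_mset (u + v) \<subseteq> G n m"
      using F_subset_G[OF n_pos n_le_m] by (auto simp: E_def)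
    then obtain T where T: "T \<in> SSYT n m" "content T = total_content (u + v)"
      by (rule star_of_columns)
    have parts: "E_part n m u = u" "E_part n m v = {#}" "F_part n m u = {#}" "F_part n m v = v"
      using uv by (auto simp: E_def filter_mset_eq_conv)
    have "tableau_parts n m T =
        (product_ideal n m +>\<^bsub>E_algebra n m\<^esub> Poly_Mapping.single u 1, Poly_Mapping.single v (1::'k))"
      using tableau_parts_eq[OF T(1) G T(2)[symmetric], where 'k = 'k] by (simp add: parts)
    then show "Poly_Mapping.single
        (product_ideal n m +>\<^bsub>E_algebra n m\<^esub> Poly_Mapping.single u 1, Poly_Mapping.single v (1::'k)) 1 \<in> ?D"
      using T(1) zero by (intro CollectI exI[of _ "Poly_Mapping.single T 1"]) simp
  next
    show "Poly_Mapping.keys z \<subseteq> carrier (residue_algebra n m \<times>\<times> (F_algebra n m :: ('k, _) module))"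
      using assms by simp
  qed
  then show thesis using that by blast
qed

lemma tableaux_algebra_iso_tensor:
  "algebra_isomorphic
    (tableaux_algebra n m :: ('k::field, tableau \<Rightarrow>\<^sub>0 'k) module)
    (tensor_algebra
      (quotient_algebra (polynomial_algebra (E n m)) (product_ideal n m))
      (polynomial_algebra (F n m)))"
proof -
  let ?T = "tableaux_algebra n m :: ('k, tableau \<Rightarrow>\<^sub>0 'k) module"
  let ?AB = "pair_algebra n m :: ('k, _) module"
  let ?I = "bilinearity_ideal n m :: ('k tableau_poly set \<times> _ \<Rightarrow>\<^sub>0 'k) set"
  let ?Q = "quotient_algebra ?AB ?I"
  let ?b = "basis_map (tableau_parts n m) :: _ \<Rightarrow> ('k tableau_poly set \<times> _ \<Rightarrow>\<^sub>0 'k)"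
  let ?h = "\<lambda>p. ?I +>\<^bsub>?AB\<^esub> ?b p"
  have T: "carrier ?T = {p. Poly_Mapping.keys p \<subseteq> SSYT n m}" by (simp add: tableaux_algebra_def)
  have b: "?b \<in> ring_hom ?T ?AB"
    unfolding tableaux_algebra_def
    by (rule basis_map_ring_hom[OF comm_monoid_tableau_monoid comm_monoid_pairs tableau_parts_hom])
       (simp only: tableau_monoid_simps tableau_parts_one)
  have coset_eq: "?I +>\<^bsub>?AB\<^esub> x = ?I +>\<^bsub>?AB\<^esub> y \<longleftrightarrow> x - y \<in> ?I" if "x \<in> carrier ?AB" "y \<in> carrier ?AB" for x y
    using comm_monoid.monoid_algebra_coset_eq_iff[OF comm_monoid_pairs ideal_bilinearity_ideal, of x y] that
    by simp
  have hom: "?h \<in> ring_hom ?T ?Q"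
    using ring_hom_trans[OF b quotient_map_ring_hom[OF ideal_bilinearity_ideal]] by (simp add: comp_def)
  have bij: "bij_betw ?h (carrier ?T) (carrier ?Q)"
  proof (rule bij_betw_imageI)
    show "inj_on ?h (carrier ?T)"
    proof (rule inj_onI)
      fix p q assume pq: "p \<in> carrier ?T" "q \<in> carrier ?T" "?h p = ?h q"
      then have "?b p - ?b q \<in> ?I" using coset_eq ring_hom_closed[OF b] by blast
      then show "p = q" using tableau_parts_independent pq(1,2) unfolding T by blast
    qed
    show "?h ` carrier ?T = carrier ?Q"
    proof (intro subset_antisym subsetI)
      fix X assume "X \<in> ?h ` carrier ?T"
      then show "X \<in> carrier ?Q"
        using ring_hom_closed[OF b] unfolding carrier_quotient_algebra by blast
    next
      fix X assume "X \<in> carrier ?Q"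
      then obtain z where z: "X = ?I +>\<^bsub>?AB\<^esub> z" "z \<in> carrier ?AB"
        unfolding carrier_quotient_algebra by blast
      obtain p where p: "Poly_Mapping.keys p \<subseteq> SSYT n m" "z - ?b p \<in> ?I"
        using tableau_parts_spanning[OF z(2)] by blast
      then have "p \<in> carrier ?T" by (simp add: T)
      then have "X = ?h p" using p(2) z coset_eq ring_hom_closed[OF b] by blast
      then show "X \<in> ?h ` carrier ?T" using \<open>p \<in> carrier ?T\<close> by blast
    qed
  qed
  have smult: "?h (c \<odot>\<^bsub>?T\<^esub> p) = c \<odot>\<^bsub>?Q\<^esub> ?h p" if "p \<in> carrier ?T" for c p
    using comm_monoid.quotient_monoid_algebra_smult[OF comm_monoid_pairs ideal_bilinearity_ideal, of "?b p" c]
      ring_hom_closed[OF b that]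
    by (simp add: tableaux_algebra_def)
  have "?h \<in> ring_iso ?T ?Q" using hom bij by (simp only: ring_iso_def mem_Collect_eq)
  then have "algebra_isomorphic ?T ?Q"
    unfolding algebra_isomorphic_def by (rule bexI[rotated]) (intro allI ballI smult)
  then show ?thesis
    by (simp only: tensor_algebra_def polynomial_algebra_def bilinearity_ideal_def)
qed

end

theorem corollary2p20:
  fixes n m :: nat
  assumes "0 < n" and "n \<le> m"
  shows "(product_relations n m :: 'k::{alg_closed_field, field_char_0} tableau_poly set)
        \<subseteq> carrier (polynomial_algebra (E n m)) \<and>
    algebra_isomorphic
      (tableaux_algebra n m :: ('k, tableau \<Rightarrow>\<^sub>0 'k) module)
      (tensor_algebra
        (quotient_algebra (polynomial_algebra (E n m)) (product_ideal n m))
        (polynomial_algebra (F n m))) \<and>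
    primeideal (product_ideal n m :: 'k tableau_poly set) (polynomial_algebra (E n m)) \<and>
    primeideal
      (Idl\<^bsub>tableaux_algebra n m\<^esub> (tableau_map n m ` (product_ideal n m :: 'k tableau_poly set)))
      (tableaux_algebra n m)"
  using product_relations_carrier[OF assms] tableaux_algebra_iso_tensor[OF assms]
    product_ideal_prime[OF assms] image_ideal_prime[OF assms]
  by blast

end
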